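(* Let $(t_j)_{j\in\mathbb Z}$ be real numbers with $t_{-j}=t_j$ and $\sum_{j=-\infty}^{+\infty}|t_j|<+\infty$, and let $f(z)=\sum_{j=-\infty}^{+\infty}t_jz^j$ for $z\in\mathbb C$, $|z|=1$ (a real-valued function), with minimum value $f_{\min}$ and maximum value $f_{\max}$. For each $n\in\mathbb N$ let $T_n(f)=(t_{|k-j|})_{k,j=0}^{n-1}$, and let $G_n(f)=C_n(f)+B_n(f)$, with $C_n(f)\in\mathcal C_n$ and $B_n(f)\in\mathcal B_n$, be the matrix of $\mathcal G_n$ that minimizes $\|G-T_n(f)\|_F$ over $G\in\mathcal G_n$. Then: 1) for every $\varepsilon>0$ there is a positive integer $n_0$ such that for each $n\ge n_0$ and for every eigenvalue $\lambda_j^{(G_n(f))}$ of $G_n(f)$, one has $\lambda_j^{(G_n(f))}\in[f_{\min}-\varepsilon,\,f_{\max}+\varepsilon]$, $j\in\{0,1,\dots,n-1\}$; 2) for every $\varepsilon>0$ there are $k,n_1\in\mathbb N$ such that for each $n\ge n_1$ the number of eigenvalues $\lambda$ of $(G_n(f))^{-1}T_n(f)$ with $|\lambda-1|>\varepsilon$ is less than $k$; that is, the spectrum of $(G_n(f))^{-1}T_n(f)$ is clustered around $1$.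
   Context: Rows, columns and vector components are indexed by $0,1,\dots,n-1$; $\|\cdot\|_F$ is the Frobenius norm. $Q_n$ is the real $n\times n$ matrix whose columns $\mathbf q^{(0)},\dots,\mathbf q^{(n-1)}$ are as follows: $\mathbf q^{(0)}=\frac1{\sqrt n}(1,\dots,1)^T$; for $1\le j\le\lfloor\frac{n-1}2\rfloor$, $\mathbf q^{(j)}$ has $k$-th entry $\sqrt{2/n}\,\cos(2\pi kj/n)$ and $\mathbf q^{(n-j)}$ has $k$-th entry $\sqrt{2/n}\,\sin(2\pi kj/n)$, $k=0,\dots,n-1$; if $n$ is even, $\mathbf q^{(n/2)}$ has $k$-th entry $(-1)^k/\sqrt n$. ($Q_n$ is orthogonal.) A vector $\boldsymbol\lambda\in\mathbb R^n$ is symmetric (resp. asymmetric) if $\lambda_j=\lambda_{(n-j)\bmod n}$ (resp. $\lambda_j=-\lambda_{(n-j)\bmod n}$) for all $j$. $\mathcal G_n=\{Q_n\,\mathrm{diag}(\boldsymbol\lambda)Q_n^T:\boldsymbol\lambda\in\mathbb R^n\}$; $\mathcal C_n$ (resp. $\mathcal B_n$) is the subset with $\boldsymbol\lambda$ symmetric (resp. asymmetric). $\mathcal G_n$ is a linear subspace of $\mathbb R^{n\times n}$ and is the direct sum of $\mathcal C_n$ and $\mathcal B_n$, so $G_n(f)$, $C_n(f)$, $B_n(f)$ are uniquely determined.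
   Formalization: Part 2 is proved under the added hypothesis that f has no zero on the unit circle (f_min > 0 or f_max < 0); without it the claim fails, e.g. for f = 0 (G_n not invertible) or f = 2 - z - 1/z (about sqrt(n) eigenvalues of G_n^{-1}T_n stay at most 1/2). *)

theory Defs
  imports "HOL-Analysis.Infinite_Sum" "Jordan_Normal_Form.Gauss_Jordan_Elimination"
    "Jordan_Normal_Form.Char_Poly"
begin

definition frobenius_norm :: "real mat \<Rightarrow> real" where
  "frobenius_norm A = sqrt (\<Sum>i<dim_row A. \<Sum>j<dim_col A. (A $$ (i, j))\<^sup>2)"

(* In the last branch j > n / 2, so column j is q^(n-j') for j' = n - j. *)
definition gamma_Q :: "nat \<Rightarrow> real mat" where
  "gamma_Q n = mat n n (\<lambda>(k, j).
     if j = 0 then 1 / sqrt (real n)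
     else if j \<le> (n - 1) div 2 then sqrt (2 / real n) * cos (2 * pi * real k * real j / real n)
     else if 2 * j = n then (- 1) ^ k / sqrt (real n)
     else sqrt (2 / real n) * sin (2 * pi * real k * real (n - j) / real n))"

definition symmetric_vec :: "real vec \<Rightarrow> bool" where
  "symmetric_vec l \<longleftrightarrow> (\<forall>j<dim_vec l. l $ j = l $ ((dim_vec l - j) mod dim_vec l))"

definition asymmetric_vec :: "real vec \<Rightarrow> bool" where
  "asymmetric_vec l \<longleftrightarrow> (\<forall>j<dim_vec l. l $ j = - (l $ ((dim_vec l - j) mod dim_vec l)))"

definition gamma_mat :: "nat \<Rightarrow> real vec \<Rightarrow> real mat" where
  "gamma_mat n l = gamma_Q n * mat_diag n (\<lambda>j. l $ j) * transpose_mat (gamma_Q n)"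

definition gamma_space :: "nat \<Rightarrow> real mat set" where
  "gamma_space n = {gamma_mat n l | l. l \<in> carrier_vec n}"

definition C_space :: "nat \<Rightarrow> real mat set" where
  "C_space n = {gamma_mat n l | l. l \<in> carrier_vec n \<and> symmetric_vec l}"

definition B_space :: "nat \<Rightarrow> real mat set" where
  "B_space n = {gamma_mat n l | l. l \<in> carrier_vec n \<and> asymmetric_vec l}"

definition symbol :: "(int \<Rightarrow> real) \<Rightarrow> complex \<Rightarrow> complex" where
  "symbol t z = (\<Sum>\<^sub>\<infinity>j. complex_of_real (t j) * z powi j)"

(* The symbol is real-valued on the unit circle for summable even coefficients, so these are
   its minimum and maximum values there. *)
definition symbol_min :: "(int \<Rightarrow> real) \<Rightarrow> real" where
  "symbol_min t = (LEAST y. \<exists>z. cmod z = 1 \<and> symbol t z = complex_of_real y)"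

definition symbol_max :: "(int \<Rightarrow> real) \<Rightarrow> real" where
  "symbol_max t = (GREATEST y. \<exists>z. cmod z = 1 \<and> symbol t z = complex_of_real y)"

definition toeplitz :: "(int \<Rightarrow> real) \<Rightarrow> nat \<Rightarrow> real mat" where
  "toeplitz t n = mat n n (\<lambda>(k, j). t \<bar>int k - int j\<bar>)"

(* Meaningful only for invertible A. *)
definition inv_mat :: "real mat \<Rightarrow> real mat" where
  "inv_mat A = the (mat_inverse A)"

(* Complex eigenvalues, repeated according to algebraic multiplicity. *)
definition eigenvalue_mset :: "real mat \<Rightarrow> complex multiset" where
  "eigenvalue_mset A = proots (char_poly (map_mat complex_of_real A))"

end

theory Submission
  imports Defs "HOL-Analysis.Convex"
begin

text \<open>
  By Pythagoras in the Frobenius inner product, the minimiser is \<open>G\<^sub>n = Q diag(\<tau>) Q\<^sup>T\<close> with the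
  Rayleigh quotients \<open>\<tau>\<^sub>j = q\<^sub>j\<^sup>T T\<^sub>n q\<^sub>j\<close>.  Truncate the symbol at degree \<open>K\<close> so that the tail of the
  coefficients is small.  The circulant \<open>D = Q diag(f\<^sub>K(2\<pi>j/n)) Q\<^sup>T\<close> agrees with the truncated
  Toeplitz matrix except in two corners of size \<open>K\<close>, so \<open>T\<^sub>n = D + R + E\<close> where \<open>R\<close> has at most
  \<open>2K\<close> nonzero rows with bounded entries and \<open>E\<close> has small row sums.  Evaluating at \<open>q\<^sub>j\<close>, whose
  entries are \<open>O(n\<^sup>-\<^sup>1\<^sup>/\<^sup>2)\<close>, gives \<open>\<tau>\<^sub>j = f\<^sub>K(2\<pi>j/n) + O(1/n) + O(\<parallel>E\<parallel>)\<close>, which is the first claim.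
  Hence \<open>T\<^sub>n - G\<^sub>n\<close> is \<open>R\<close> plus a matrix of small norm, and \<open>G\<^sub>n\<close> is definite with a uniform bound
  when \<open>f\<close> has no zero; so \<open>G\<^sub>n\<^sup>-\<^sup>1 T\<^sub>n\<close> is similar to a symmetric matrix that differs from the
  identity by rank \<open>2K\<close> and a small norm, and at most \<open>2K\<close> of its eigenvalues are far from 1.
\<close>

subsection \<open>Real symmetric matrices\<close>

lemma index_mult_mat_sum:
  assumes "A \<in> carrier_mat m n" "B \<in> carrier_mat n p" "i < m" "j < p"
  shows "(A * B) $$ (i, j) = (\<Sum>k<n. A $$ (i, k) * B $$ (k, j))"
  using assms by (auto simp: scalar_prod_def lessThan_atLeast0 intro!: sum.cong)

lemma index_mult_mat_vec_sum:
  assumes "A \<in> carrier_mat m n" "v \<in> carrier_vec n" "i < m"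
  shows "(A *\<^sub>v v) $ i = (\<Sum>k<n. A $$ (i, k) * v $ k)"
  using assms by (auto simp: scalar_prod_def lessThan_atLeast0 intro!: sum.cong)

lemma dim_mat_diag [simp]: "dim_row (mat_diag n d) = n" "dim_col (mat_diag n d) = n"
  by (simp_all add: mat_diag_def)

lemma index_mat_diag_mult_vec:
  assumes "y \<in> carrier_vec n" "i < n"
  shows "(mat_diag n d *\<^sub>v y) $ i = d i * y $ i"
proof -
  have "(mat_diag n d *\<^sub>v y) $ i = (\<Sum>k<n. mat_diag n d $$ (i, k) * y $ k)"
    using assms by (intro index_mult_mat_vec_sum) auto
  also have "\<dots> = (\<Sum>k<n. if k = i then d i * y $ i else 0)"
    using assms by (intro sum.cong refl) (auto simp: mat_diag_def)
  finally show ?thesis using assms by simp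
qed

text \<open>Over the complex numbers some eigenvector \<open>w\<close> with eigenvalue
  \<open>\<mu>\<close> exists. Symmetry makes the Hermitian form of \<open>A\<close> at
  \<open>w\<close> real, and this form is \<open>\<mu>\<close> times the squared norm of
  \<open>w\<close>, so \<open>\<mu>\<close> is real.\<close>

lemma symmetric_mat_has_real_eigenvector:
  fixes A :: "real mat"
  assumes A: "A \<in> carrier_mat n n" and sym: "transpose_mat A = A" and n: "n > 0"
  obtains e v where "v \<in> carrier_vec n" "v \<noteq> 0\<^sub>v n" "A *\<^sub>v v = e \<cdot>\<^sub>v v"
proof -
  let ?C = "map_mat complex_of_real A"
  have C: "?C \<in> carrier_mat n n" using A by simp
  obtain as where as: "char_poly ?C = (\<Prod>a\<leftarrow>as. [:- a, 1:])" "length as = n"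
    using char_poly_factorized[OF C] by blast
  then obtain \<mu> as' where "as = \<mu> # as'" using n by (cases as) auto
  then have root: "poly (char_poly ?C) \<mu> = 0" using as by simp
  then obtain w where w: "w \<in> carrier_vec n" "w \<noteq> 0\<^sub>v n" "?C *\<^sub>v w = \<mu> \<cdot>\<^sub>v w"
    using C unfolding eigenvalue_root_char_poly[OF C, symmetric] eigenvalue_def eigenvector_def
    by auto
  have Aij: "A $$ (i, j) = A $$ (j, i)" if "i < n" "j < n" for i j
    using that A sym by (metis carrier_matD index_transpose_mat(1))
  have row: "(\<Sum>j<n. A $$ (i, j) * w $ j) = \<mu> * w $ i" if "i < n" for i
  proof -
    have "(?C *\<^sub>v w) $ i = (\<Sum>j<n. ?C $$ (i, j) * w $ j)"
      by (rule index_mult_mat_vec_sum[OF C w(1) that])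
    also have "\<dots> = (\<Sum>j<n. A $$ (i, j) * w $ j)" using A that by simp
    finally show ?thesis using w that by simp
  qed
  let ?N = "\<Sum>i<n. (cmod (w $ i))\<^sup>2"
  have form: "(\<Sum>i<n. \<Sum>j<n. cnj (w $ i) * A $$ (i, j) * w $ j) = \<mu> * ?N" (is "?s = _")
  proof -
    have "?s = (\<Sum>i<n. cnj (w $ i) * (\<Sum>j<n. A $$ (i, j) * w $ j))"
      by (simp add: sum_distrib_left mult.assoc)
    also have "\<dots> = (\<Sum>i<n. \<mu> * (cmod (w $ i))\<^sup>2)"
    proof (intro sum.cong refl)
      fix i assume "i \<in> {..<n}"
      then show "cnj (w $ i) * (\<Sum>j<n. A $$ (i, j) * w $ j) = \<mu> * (cmod (w $ i))\<^sup>2"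
        using complex_norm_square[of "w $ i"] by (simp only: row lessThan_iff) (simp add: mult_ac)
    qed
    finally show ?thesis by (simp add: sum_distrib_left)
  qed
  have "cnj ?s = (\<Sum>i<n. \<Sum>j<n. w $ i * A $$ (i, j) * cnj (w $ j))"
    by simp
  also have "\<dots> = (\<Sum>j<n. \<Sum>i<n. w $ i * A $$ (i, j) * cnj (w $ j))"
    by (rule sum.swap)
  also have "\<dots> = ?s"
    by (intro sum.cong refl) (simp add: Aij mult_ac)
  finally have "cnj (\<mu> * ?N) = \<mu> * ?N" using form by simp
  moreover have N0: "?N \<noteq> 0"
  proof
    assume "?N = 0"
    then have "\<forall>i<n. w $ i = 0" by (subst (asm) sum_nonneg_eq_0_iff) auto
    then have "w = 0\<^sub>v n" using w by (intro eq_vecI) auto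
    then show False using w by simp
  qed
  ultimately have "cnj \<mu> = \<mu>"
    by (metis complex_cnj_complex_of_real complex_cnj_mult mult_cancel_right of_real_eq_0_iff)
  then obtain e where e: "\<mu> = complex_of_real e"
    by (metis Reals_cases Reals_cnj_iff)
  \<comment> \<open>The vector \<open>w\<close> may still be complex; a real eigenvector comes from
    \<open>e\<close> being a root of the real characteristic polynomial.\<close>
  have "char_poly ?C = map_poly complex_of_real (char_poly A)"
    by (rule of_real_hom.char_poly_hom[OF A])
  then have "complex_of_real (poly (char_poly A) e) = 0"
    using root e by simp
  then have "eigenvalue A e" using eigenvalue_root_char_poly[OF A] by simp
  then show thesis using that A unfolding eigenvalue_def eigenvector_def by auto
qed

text \<open>The reflection in the hyperplane orthogonal to \<open>u\<close>, the difference of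
  \<open>v\<close> and the first unit vector, exchanges these two unit vectors. It replaces a
  completion of \<open>v\<close> to an orthonormal basis.\<close>

lemma householder_reflection:
  fixes v :: "real vec"
  assumes v: "v \<in> carrier_vec n" and n: "n > 0" and unit: "(\<Sum>i<n. (v $ i)\<^sup>2) = 1"
  obtains H where "H \<in> carrier_mat n n" "transpose_mat H = H" "H * H = 1\<^sub>m n" "col H 0 = v"
proof -
  define u where "u i = v $ i - (if i = 0 then 1 else 0)" for i
  define s where "s = 2 - 2 * v $ 0"
  \<comment> \<open>If \<open>v\<close> is the first unit vector then \<open>s = 0\<close>, \<open>c = 0\<close> and \<open>H\<close> is the identity.\<close>
  define c where "c = 2 / s"
  define H where "H = mat n n (\<lambda>(i, j). (if i = j then 1 else 0) - c * u i * u j)"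
  have uu: "(\<Sum>i<n. (u i)\<^sup>2) = s"
  proof -
    have "(\<Sum>i<n. (u i)\<^sup>2) = (\<Sum>i<n. (v $ i)\<^sup>2 + (if i = 0 then 1 - 2 * v $ 0 else 0))"
      by (intro sum.cong refl) (auto simp: u_def power2_eq_square algebra_simps)
    then show ?thesis using n unit by (simp add: sum.distrib s_def)
  qed
  have u_zero: "u i = 0" if "s = 0" "i < n" for i
    using uu that sum_nonneg_eq_0_iff[of "{..<n}" "\<lambda>i. (u i)\<^sup>2"] by simp
  have H: "H \<in> carrier_mat n n" by (simp add: H_def)
  moreover have "transpose_mat H = H" by (rule eq_matI) (auto simp: H_def)
  moreover have "H * H = 1\<^sub>m n"
  proof (rule eq_matI)
    fix i j assume "i < dim_row (1\<^sub>m n :: real mat)" "j < dim_col (1\<^sub>m n :: real mat)"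
    then have ij: "i < n" "j < n" by auto
    have "(H * H) $$ (i, j) = (\<Sum>k<n. H $$ (i, k) * H $$ (k, j))"
      by (rule index_mult_mat_sum[OF H H ij])
    also have "\<dots> = (\<Sum>k<n. (if k = i then (if i = j then 1 else 0) - c * u i * u j else 0)
        + (if k = j then - c * u i * u j else 0) + c\<^sup>2 * u i * u j * (u k)\<^sup>2)"
      by (intro sum.cong refl) (use ij in \<open>auto simp: H_def power2_eq_square algebra_simps\<close>)
    also have "\<dots> = (if i = j then 1 else 0) - 2 * c * u i * u j + c\<^sup>2 * u i * u j * s"
      using ij by (simp add: sum.distrib sum_distrib_left[symmetric] uu)
    also have "c\<^sup>2 * u i * u j * s = 2 * c * u i * u j"
      using u_zero ij by (cases "s = 0") (auto simp: c_def power2_eq_square)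
    finally show "(H * H) $$ (i, j) = 1\<^sub>m n $$ (i, j)" using ij by simp
  qed (auto simp: H_def)
  moreover have "col H 0 = v"
  proof (rule eq_vecI)
    fix i assume "i < dim_vec v"
    then have i: "i < n" using v by simp
    \<comment> \<open>Since \<open>u 0 = - s / 2\<close>, the product \<open>c * u 0\<close> is
      \<open>- 1\<close> unless \<open>s = 0\<close>, in which case \<open>u\<close>
      vanishes.\<close>
    have "c * u i * u 0 = - u i"
      using u_zero[of i] i by (cases "s = 0") (auto simp: c_def u_def s_def field_simps)
    then show "col H 0 $ i = v $ i"
      using i n by (auto simp: H_def u_def)
  qed (use v in \<open>simp add: H_def\<close>)
  ultimately show thesis by (rule that)
qed

text \<open>Deflation: conjugation by a Householder matrix whose first column is a unit eigenvector
  leaves only the eigenvalue in the first column, and by symmetry in the first row. The induction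
  hypothesis diagonalises the remaining block.\<close>

theorem real_spectral_theorem:
  fixes A :: "real mat"
  assumes "A \<in> carrier_mat n n" "transpose_mat A = A"
  shows "\<exists>U d. U \<in> carrier_mat n n \<and> transpose_mat U * U = 1\<^sub>m n \<and> A * U = U * mat_diag n d"
  using assms
proof (induction n arbitrary: A)
  case 0
  then show ?case by (intro exI[of _ "0\<^sub>m 0 0"] exI[of _ "\<lambda>_. 0"]) (auto intro!: eq_matI simp: mat_diag_def)
next
  case (Suc n)
  let ?n = "Suc n"
  have A: "A \<in> carrier_mat ?n ?n" and symA: "transpose_mat A = A" using Suc.prems by auto
  obtain e w where w: "w \<in> carrier_vec ?n" "w \<noteq> 0\<^sub>v ?n" "A *\<^sub>v w = e \<cdot>\<^sub>v w"
    using symmetric_mat_has_real_eigenvector[OF A symA] by blast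
  define r where "r = sqrt (\<Sum>i<?n. (w $ i)\<^sup>2)"
  have "(\<Sum>i<?n. (w $ i)\<^sup>2) \<noteq> 0"
  proof
    assume "(\<Sum>i<?n. (w $ i)\<^sup>2) = 0"
    then have "\<forall>i<?n. w $ i = 0" by (subst (asm) sum_nonneg_eq_0_iff) auto
    then have "w = 0\<^sub>v ?n" using w by (intro eq_vecI) auto
    then show False using w by simp
  qed
  moreover have "(\<Sum>i<?n. (w $ i)\<^sup>2) \<ge> 0" by (intro sum_nonneg) simp
  ultimately have pos: "(\<Sum>i<?n. (w $ i)\<^sup>2) > 0" by linarith
  define v where "v = (1 / r) \<cdot>\<^sub>v w"
  have v: "v \<in> carrier_vec ?n" using w by (simp add: v_def)
  have vi: "v $ i = w $ i / r" if "i < ?n" for i using w that by (simp add: v_def)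
  have unit: "(\<Sum>i<?n. (v $ i)\<^sup>2) = 1"
  proof -
    have "(\<Sum>i<?n. (v $ i)\<^sup>2) = (\<Sum>i<?n. (w $ i)\<^sup>2 / r\<^sup>2)"
      by (intro sum.cong refl) (simp add: vi power_divide)
    also have "\<dots> = (\<Sum>i<?n. (w $ i)\<^sup>2) / r\<^sup>2" by (simp only: sum_divide_distrib)
    also have "r\<^sup>2 = (\<Sum>i<?n. (w $ i)\<^sup>2)" unfolding r_def using pos by (intro real_sqrt_pow2) simp
    finally show ?thesis using pos by simp
  qed
  have Av: "A *\<^sub>v v = e \<cdot>\<^sub>v v"
    unfolding v_def using w A by (simp add: mult_mat_vec[OF A w(1)] smult_smult_assoc mult.commute)
  obtain H where H: "H \<in> carrier_mat ?n ?n" and symH: "transpose_mat H = H"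
    and HH: "H * H = 1\<^sub>m ?n" and Hv: "col H 0 = v"
    using householder_reflection[OF v _ unit] by blast
  let ?A' = "H * A * H"
  have A': "?A' \<in> carrier_mat ?n ?n" using A H by simp
  have symA': "transpose_mat ?A' = ?A'"
    using A H by (simp add: transpose_mult[of _ ?n ?n _ ?n] symA symH)
  have col0: "?A' $$ (i, 0) = (if i = 0 then e else 0)" if "i < ?n" for i
  proof -
    have e0: "H *\<^sub>v v = unit_vec ?n 0"
    proof -
      have "H *\<^sub>v v = col (H * H) 0" by (simp only: col_mult2[OF H H zero_less_Suc] Hv)
      then show ?thesis by (simp add: HH)
    qed
    have "col ?A' 0 = H *\<^sub>v (A *\<^sub>v v)"
      using H A v by (simp only: col_mult2[OF mult_carrier_mat[OF H A] H zero_less_Suc] Hv) simp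
    also have "\<dots> = e \<cdot>\<^sub>v unit_vec ?n 0"
      using H v by (simp add: Av mult_mat_vec[OF H v] e0)
    finally have "col ?A' 0 $ i = (e \<cdot>\<^sub>v unit_vec ?n 0) $ i" by simp
    moreover have "col ?A' 0 $ i = ?A' $$ (i, 0)"
      by (rule index_col) (use that A' in \<open>simp_all only: carrier_matD zero_less_Suc\<close>)
    ultimately show ?thesis using that by simp
  qed
  have row0: "?A' $$ (0, i) = (if i = 0 then e else 0)" if "i < ?n" for i
  proof -
    have "?A' $$ (0, i) = transpose_mat ?A' $$ (0, i)" by (simp only: symA')
    also have "\<dots> = ?A' $$ (i, 0)" using that A H by (subst index_transpose_mat) auto
    finally show ?thesis using col0[OF that] by simp
  qed
  define A3 where "A3 = mat n n (\<lambda>(i, j). ?A' $$ (Suc i, Suc j))"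
  have A3: "A3 \<in> carrier_mat n n" by (simp add: A3_def)
  have "transpose_mat A3 = A3"
  proof (rule eq_matI)
    fix i j assume "i < dim_row A3" "j < dim_col A3"
    then have ij: "i < n" "j < n" using A3 by auto
    have "?A' $$ (Suc j, Suc i) = transpose_mat ?A' $$ (Suc j, Suc i)" by (simp only: symA')
    also have "\<dots> = ?A' $$ (Suc i, Suc j)" using ij A H by (subst index_transpose_mat) auto
    finally show "transpose_mat A3 $$ (i, j) = A3 $$ (i, j)" using ij by (simp add: A3_def)
  qed (use A3 in auto)
  from Suc.IH[OF A3 this] obtain U3 d3 where U3: "U3 \<in> carrier_mat n n"
    "transpose_mat U3 * U3 = 1\<^sub>m n" "A3 * U3 = U3 * mat_diag n d3" by blast
  let ?z = "0\<^sub>m 1 n :: real mat" and ?z' = "0\<^sub>m n 1 :: real mat"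
  let ?E = "mat 1 1 (\<lambda>_. e)"
  \<comment> \<open>Direct sum of the scalar 1 and the smaller orthogonal matrix;
    \<open>H * V\<close> will diagonalise \<open>A\<close>.\<close>
  define V where "V = four_block_mat (1\<^sub>m 1) ?z ?z' U3"
  define d where "d i = (case i of 0 \<Rightarrow> e | Suc j \<Rightarrow> d3 j)" for i
  have V: "V \<in> carrier_mat ?n ?n" unfolding V_def using U3 four_block_carrier_mat[of "1\<^sub>m 1" 1 1 U3 n n] by simp
  have VV: "transpose_mat V * V = 1\<^sub>m ?n"
  proof -
    have "transpose_mat V = four_block_mat (1\<^sub>m 1) ?z ?z' (transpose_mat U3)"
      unfolding V_def using U3 by (subst transpose_four_block_mat[of _ 1 1 _ n _ n]) auto
    then have "transpose_mat V * V = four_block_mat (1\<^sub>m 1) ?z ?z' (1\<^sub>m n)"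
      unfolding V_def using U3 by (simp add: mult_four_block_mat[of _ 1 1 _ n _ n _ _ 1 _ n])
    then show ?thesis by simp
  qed
  have blockA: "?A' = four_block_mat ?E ?z ?z' A3"
    by (rule eq_matI)
      (use A H A3 in \<open>auto simp: A3_def col0 row0 simp del: index_mult_mat(1) assoc_mult_mat\<close>)
  have blockD: "mat_diag ?n d = four_block_mat ?E ?z ?z' (mat_diag n d3)"
    by (rule eq_matI) (auto simp: mat_diag_def d_def split: nat.split)
  have A'V: "?A' * V = V * mat_diag ?n d"
    unfolding blockA blockD unfolding V_def using U3 A3
    by (simp add: mult_four_block_mat[of _ 1 1 _ n _ n _ _ 1 _ n])
  have "transpose_mat (H * V) * (H * V) = transpose_mat V * (H * H) * V"
    using H V by (simp add: transpose_mult[of H ?n ?n V ?n] symH assoc_mult_mat[of _ ?n ?n _ ?n _ ?n])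
  then have "transpose_mat (H * V) * (H * V) = 1\<^sub>m ?n" using VV V HH by simp
  moreover have "A * (H * V) = H * V * mat_diag ?n d"
  proof -
    have "A * (H * V) = (H * H) * (A * (H * V))" unfolding HH using A H V by simp
    also have "\<dots> = H * (?A' * V)"
      using A H V by (simp add: assoc_mult_mat[of _ ?n ?n _ ?n _ ?n])
    also have "\<dots> = H * V * mat_diag ?n d" unfolding A'V using H V by (simp add: assoc_mult_mat[of _ ?n ?n _ ?n _ ?n])
    finally show ?thesis .
  qed
  moreover have "H * V \<in> carrier_mat ?n ?n" using H V by simp
  ultimately show ?case by blast
qed

section \<open>Eigenvalues counted with multiplicity\<close>

lemma eigenvalue_mset_alt:
  assumes "A \<in> carrier_mat n n"
  shows "eigenvalue_mset A = proots (map_poly complex_of_real (char_poly A))"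
  by (simp add: eigenvalue_mset_def of_real_hom.char_poly_hom[OF assms])

lemma eigenvalue_mset_similar:
  assumes "similar_mat A B"
  shows "eigenvalue_mset A = eigenvalue_mset B"
proof -
  obtain n where "A \<in> carrier_mat n n" "B \<in> carrier_mat n n"
    using similar_matD[OF assms] by auto
  then show ?thesis using char_poly_similar[OF assms] by (simp add: eigenvalue_mset_alt)
qed

lemma eigenvalue_mset_mat_diag:
  "eigenvalue_mset (mat_diag n d) = image_mset (\<lambda>i. complex_of_real (d i)) (mset_set {..<n})"
proof -
  have "map_mat complex_of_real (mat_diag n d) = mat_diag n (\<lambda>i. complex_of_real (d i))"
    by (rule eq_matI) (auto simp: mat_diag_def)
  moreover have "upper_triangular (mat_diag n (\<lambda>i. complex_of_real (d i)))"
    by (auto simp: mat_diag_def)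
  moreover have "diag_mat (mat_diag n (\<lambda>i. complex_of_real (d i)))
      = map (\<lambda>i. complex_of_real (d i)) [0..<n]"
    by (simp add: diag_mat_def) (simp add: mat_diag_def)
  ultimately have "eigenvalue_mset (mat_diag n d)
      = proots (\<Prod>a\<leftarrow>map (\<lambda>i. complex_of_real (d i)) [0..<n]. [:- a, 1:])"
    unfolding eigenvalue_mset_def by (simp only: char_poly_upper_triangular[OF mat_diag_dim])
  also have "\<dots> = mset (map (\<lambda>i. complex_of_real (d i)) [0..<n])"
  proof -
    have "proots (\<Prod>a\<leftarrow>as. [:- a, 1:]) = mset as" for as :: "complex list"
    proof (induction as)
      case (Cons a as)
      have "(\<Prod>a\<leftarrow>as. [:- a, 1:]) \<noteq> (0 :: complex poly)"
        by (auto simp: prod_list_zero_iff)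
      then have "proots ([:- a, 1:] * (\<Prod>a\<leftarrow>as. [:- a, 1:])) = {#a#} + mset as"
        by (subst proots_mult) (auto simp: Cons.IH)
      then show ?case by simp
    qed simp
    then show ?thesis .
  qed
  finally show ?thesis by (simp add: lessThan_atLeast0 mset_upt[symmetric] del: mset_upt)
qed

lemma orthogonal_mat_norm:
  fixes U :: "real mat"
  assumes U: "U \<in> carrier_mat n n" "transpose_mat U * U = 1\<^sub>m n" and y: "y \<in> carrier_vec n"
  shows "(\<Sum>i<n. ((U *\<^sub>v y) $ i)\<^sup>2) = (\<Sum>i<n. (y $ i)\<^sup>2)"
proof -
  have sq: "(\<Sum>i<n. (z $ i)\<^sup>2) = z \<bullet> z" if "z \<in> carrier_vec n" for z :: "real vec"
    using that by (simp add: scalar_prod_def lessThan_atLeast0 power2_eq_square)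
  have "(U *\<^sub>v y) \<bullet> (U *\<^sub>v y) = (transpose_mat U *\<^sub>v (U *\<^sub>v y)) \<bullet> y"
    using U y by (subst transpose_vec_mult_scalar[of _ n n]) auto
  also have "transpose_mat U *\<^sub>v (U *\<^sub>v y) = (transpose_mat U * U) *\<^sub>v y"
    using U y by (subst assoc_mult_mat_vec[of _ n n _ n]) auto
  also have "\<dots> = y" using U(2) y by simp
  finally show ?thesis using U y sq[of y] sq[of "U *\<^sub>v y"] by simp
qed

text \<open>Padding \<open>M\<close> with zero rows to a square matrix does not change the kernel,
  and the determinant vanishes because \<open>r < m\<close> leaves at least one zero row.\<close>

lemma nontrivial_kernel_of_wide_mat:
  fixes M :: "real mat"
  assumes M: "M \<in> carrier_mat r m" and rm: "r < m"
  obtains y where "y \<in> carrier_vec m" "y \<noteq> 0\<^sub>v m" "M *\<^sub>v y = 0\<^sub>v r"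
proof -
  define N where "N = mat m m (\<lambda>(i, j). if i < r then M $$ (i, j) else 0)"
  have N: "N \<in> carrier_mat m m" by (simp add: N_def)
  have "det N = 0"
  proof -
    have "N = mat\<^sub>r m m (\<lambda>i. if i = r then 0\<^sub>v m else row N i)"
      by (rule eq_matI) (auto simp: N_def)
    then show ?thesis using det_row_0[of r m "row N"] N rm by auto
  qed
  then obtain y where y: "y \<in> carrier_vec m" "y \<noteq> 0\<^sub>v m" "N *\<^sub>v y = 0\<^sub>v m"
    using det_0_iff_vec_prod_zero[OF N] by auto
  have "M *\<^sub>v y = 0\<^sub>v r"
  proof (rule eq_vecI)
    fix i assume "i < dim_vec (0\<^sub>v r :: real vec)"
    then have i: "i < r" by simp
    have "row M i = row N i" using M i rm by (intro eq_vecI) (auto simp: N_def)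
    then have "(M *\<^sub>v y) $ i = (N *\<^sub>v y) $ i" using M N i rm by simp
    then show "(M *\<^sub>v y) $ i = 0\<^sub>v r $ i" using y i rm by simp
  qed (use M in auto)
  with y show thesis using that by blast
qed

text \<open>A dimension count: eigenvectors for more than \<open>r\<close> far eigenvalues span a
  space that meets the kernel of \<open>Y\<close> nontrivially, as \<open>Y\<close> has only
  \<open>r\<close> rows. On this span \<open>S - c\<close> stretches norms by more than
  \<open>\<epsilon>\<close>, against the bound on the kernel.\<close>

theorem eigenvalue_count_le:
  fixes S Y :: "real mat"
  assumes S: "S \<in> carrier_mat n n" "transpose_mat S = S"
    and Y: "Y \<in> carrier_mat r n" and \<epsilon>: "\<epsilon> \<ge> 0"
    and bound: "\<And>x. x \<in> carrier_vec n \<Longrightarrow> Y *\<^sub>v x = 0\<^sub>v r \<Longrightarrow>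
      (\<Sum>i<n. ((S *\<^sub>v x) $ i - c * x $ i)\<^sup>2) \<le> \<epsilon>\<^sup>2 * (\<Sum>i<n. (x $ i)\<^sup>2)"
  shows "size {#\<mu> \<in># eigenvalue_mset S. cmod (\<mu> - complex_of_real c) > \<epsilon>#} \<le> r"
proof -
  obtain U d where U: "U \<in> carrier_mat n n" "transpose_mat U * U = 1\<^sub>m n"
    and SU: "S * U = U * mat_diag n d"
    using real_spectral_theorem[OF S] by blast
  have UU: "U * transpose_mat U = 1\<^sub>m n"
    by (rule mat_mult_left_right_inverse[OF _ U(1) U(2)]) (use U in auto)
  have "S = S * (U * transpose_mat U)" using S UU by simp
  also have "\<dots> = S * U * transpose_mat U" using S U by simp
  finally have "S = U * mat_diag n d * transpose_mat U" by (simp only: SU)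
  then have "similar_mat_wit S (mat_diag n d) U (transpose_mat U)"
    using S U UU by (simp add: similar_mat_wit_def)
  then have "eigenvalue_mset S = image_mset (\<lambda>i. complex_of_real (d i)) (mset_set {..<n})"
    using eigenvalue_mset_similar eigenvalue_mset_mat_diag unfolding similar_mat_def by metis
  define J where "J = {i \<in> {..<n}. \<bar>d i - c\<bar> > \<epsilon>}"
  have "cmod (complex_of_real (d i) - complex_of_real c) = \<bar>d i - c\<bar>" for i
    by (metis norm_of_real of_real_diff real_norm_def)
  then have count: "size {#\<mu> \<in># eigenvalue_mset S. cmod (\<mu> - complex_of_real c) > \<epsilon>#} = card J"
    unfolding \<open>eigenvalue_mset S = _\<close> J_def by (simp add: filter_mset_image_mset filter_mset_mset_set)
  show ?thesis
  proof (rule ccontr)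
    assume "\<not> ?thesis"
    then have rJ: "r < card J" using count by simp
    define m where "m = card J"
    have J: "finite J" "J \<subseteq> {..<n}" by (auto simp: J_def)
    obtain h where h: "bij_betw h {..<m} J"
      using ex_bij_betw_nat_finite[OF J(1)] unfolding m_def lessThan_atLeast0 by blast
    have hn: "h b < n" if "b < m" for b using h J that by (auto simp: bij_betw_def)
    \<comment> \<open>The columns of \<open>Y * U\<close> that belong to far eigenvalues; there are
      \<open>m > r\<close> of them, so a nonzero \<open>z\<close> is annihilated.\<close>
    define M where "M = mat r m (\<lambda>(a, b). (Y * U) $$ (a, h b))"
    obtain z where z: "z \<in> carrier_vec m" "z \<noteq> 0\<^sub>v m" "M *\<^sub>v z = 0\<^sub>v r"
      using nontrivial_kernel_of_wide_mat[of M r m] rJ by (auto simp: M_def m_def)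
    \<comment> \<open>Extension of \<open>z\<close> by zero in the other eigendirections, which puts
      \<open>U *\<^sub>v y\<close> into the span of the far eigenvectors.\<close>
    define y where "y = vec n (\<lambda>i. if i \<in> J then z $ inv_into {..<m} h i else 0)"
    have y: "y \<in> carrier_vec n" by (simp add: y_def)
    have yh: "y $ h b = z $ b" if "b < m" for b
      using h that hn[OF that] by (auto simp: y_def bij_betw_def)
    have yJ: "y $ i = 0" if "i < n" "i \<notin> J" for i using that by (simp add: y_def)
    let ?x = "U *\<^sub>v y"
    have "Y *\<^sub>v ?x = 0\<^sub>v r"
    proof (rule eq_vecI)
      fix a assume "a < dim_vec (0\<^sub>v r :: real vec)"
      then have a: "a < r" by simp
      have "(Y *\<^sub>v ?x) $ a = ((Y * U) *\<^sub>v y) $ a" using Y U y by simp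
      also have "\<dots> = (\<Sum>i<n. (Y * U) $$ (a, i) * y $ i)"
        using Y U y a by (intro index_mult_mat_vec_sum) auto
      also have "\<dots> = (\<Sum>i\<in>J. (Y * U) $$ (a, i) * y $ i)"
        using J yJ by (intro sum.mono_neutral_right) auto
      also have "\<dots> = (\<Sum>b<m. (Y * U) $$ (a, h b) * y $ h b)"
        by (rule sum.reindex_bij_betw[OF h, symmetric])
      also have "\<dots> = (\<Sum>b<m. M $$ (a, b) * z $ b)"
        using a by (intro sum.cong refl) (simp add: M_def yh)
      also have "\<dots> = (M *\<^sub>v z) $ a"
        using a z by (intro index_mult_mat_vec_sum[symmetric]) (auto simp: M_def)
      finally show "(Y *\<^sub>v ?x) $ a = 0\<^sub>v r $ a" using z by simp
    qed (use Y in auto)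
    then have le: "(\<Sum>i<n. ((S *\<^sub>v ?x) $ i - c * ?x $ i)\<^sup>2) \<le> \<epsilon>\<^sup>2 * (\<Sum>i<n. (?x $ i)\<^sup>2)"
      using U y by (intro bound) auto
    \<comment> \<open>In the eigenbasis \<open>S - c\<close> acts by the factors
      \<open>d i - c\<close>. As \<open>U\<close> preserves norms, it suffices to compare
      \<open>w\<close> with \<open>y\<close>.\<close>
    define w where "w = vec n (\<lambda>i. (d i - c) * y $ i)"
    have w: "w \<in> carrier_vec n" by (simp add: w_def)
    have Dy: "mat_diag n d *\<^sub>v y = vec n (\<lambda>i. d i * y $ i)"
      using y by (intro eq_vecI) (auto simp: index_mat_diag_mult_vec simp del: index_mult_mat_vec)
    have "S *\<^sub>v ?x = (S * U) *\<^sub>v y" using S U y by simp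
    also have "\<dots> = U *\<^sub>v (mat_diag n d *\<^sub>v y)"
      unfolding SU using U y by (simp add: assoc_mult_mat_vec[of _ n n _ n])
    finally have Sx: "S *\<^sub>v ?x = U *\<^sub>v vec n (\<lambda>i. d i * y $ i)" by (simp only: Dy)
    have "(S *\<^sub>v ?x) $ i - c * ?x $ i = (U *\<^sub>v w) $ i" if "i < n" for i
      unfolding Sx using U y w that
      by (simp add: index_mult_mat_vec_sum[of _ n n] del: index_mult_mat_vec)
        (simp add: w_def sum_distrib_left sum_subtractf[symmetric] algebra_simps)
    then have "(\<Sum>i<n. ((S *\<^sub>v ?x) $ i - c * ?x $ i)\<^sup>2) = (\<Sum>i<n. (w $ i)\<^sup>2)"
      using orthogonal_mat_norm[OF U w] by simp
    then have "(\<Sum>i<n. (w $ i)\<^sup>2) \<le> \<epsilon>\<^sup>2 * (\<Sum>i<n. (y $ i)\<^sup>2)"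
      using le orthogonal_mat_norm[OF U y] by simp
    moreover have "\<epsilon>\<^sup>2 * (\<Sum>i<n. (y $ i)\<^sup>2) < (\<Sum>i<n. (w $ i)\<^sup>2)"
      unfolding sum_distrib_left
    proof (rule sum_strict_mono_ex1)
      have sq: "\<epsilon>\<^sup>2 < (d i - c)\<^sup>2" if "i \<in> J" for i
        using that \<epsilon> power_strict_mono[of \<epsilon> "\<bar>d i - c\<bar>" 2] by (simp add: J_def)
      show "\<forall>i\<in>{..<n}. \<epsilon>\<^sup>2 * (y $ i)\<^sup>2 \<le> (w $ i)\<^sup>2"
      proof
        fix i assume i: "i \<in> {..<n}"
        show "\<epsilon>\<^sup>2 * (y $ i)\<^sup>2 \<le> (w $ i)\<^sup>2"
          using i sq[of i] yJ[of i]
          by (cases "i \<in> J") (auto simp: w_def power_mult_distrib intro!: mult_right_mono)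
      qed
      \<comment> \<open>Strict inequality needs one nonzero coordinate in \<open>J\<close>, supplied
        by a nonzero entry of \<open>z\<close>.\<close>
      obtain b where b: "b < m" "z $ b \<noteq> 0" using z by (metis carrier_vecD eq_vecI index_zero_vec)
      then have "h b \<in> J" "y $ h b \<noteq> 0" using h yh by (auto simp: bij_betw_def)
      then show "\<exists>i\<in>{..<n}. \<epsilon>\<^sup>2 * (y $ i)\<^sup>2 < (w $ i)\<^sup>2"
        using hn[OF b(1)] sq[of "h b"]
        by (intro bexI[of _ "h b"]) (auto simp: w_def power_mult_distrib)
    qed simp
    ultimately show False by simp
  qed
qed

subsection \<open>The orthogonal matrix of the gamma algebra\<close>

text \<open>This is the real part of a geometric sum over the powers of an \<open>n\<close>-th root
  of unity; that root is 1 exactly when \<open>n\<close> divides \<open>a\<close>.\<close>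

lemma sum_cos_equidistributed:
  fixes a :: int
  assumes n: "n > 0"
  shows "(\<Sum>j<n. cos (2 * pi * real_of_int a * real j / real n)) = (if int n dvd a then real n else 0)"
proof -
  let ?z = "cis (2 * pi * real_of_int a / real n)"
  have pow: "?z ^ j = cis (2 * pi * real_of_int a * real j / real n)" for j
    by (simp add: DeMoivre mult_ac)
  have z1: "?z = 1 \<longleftrightarrow> int n dvd a"
  proof
    assume "?z = 1"
    then have "cos (2 * pi * real_of_int a / real n) = 1" by (simp add: complex_eq_iff)
    then obtain m :: int where "2 * pi * real_of_int a / real n = real_of_int m * 2 * pi"
      using cos_one_2pi_int by auto
    then have "real_of_int a = real_of_int (m * int n)" using n by (simp add: field_simps)
    then show "int n dvd a" by (metis dvd_triv_right of_int_eq_iff)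
  next
    assume "int n dvd a"
    then obtain m where "a = int n * m" by blast
    then have "2 * pi * real_of_int a / real n = 2 * pi * real_of_int m" using n by simp
    then show "?z = 1" by (simp add: cis_multiple_2pi)
  qed
  have "(\<Sum>j<n. cos (2 * pi * real_of_int a * real j / real n)) = Re (\<Sum>j<n. ?z ^ j)"
    by (simp add: pow)
  also have "(\<Sum>j<n. ?z ^ j) = (if int n dvd a then of_nat n else 0)"
  proof (cases "?z = 1")
    case True
    then show ?thesis using z1 by simp
  next
    case False
    have "?z ^ n = cis (2 * pi * real_of_int a)" using n by (simp add: pow)
    then have "?z ^ n = 1" by (simp add: cis_multiple_2pi)
    then show ?thesis using False z1 by (simp add: geometric_sum)
  qed
  finally show ?thesis by simp
qed

lemma gamma_Q_carrier [simp]: "gamma_Q n \<in> carrier_mat n n"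
  and gamma_Q_dim [simp]: "dim_row (gamma_Q n) = n" "dim_col (gamma_Q n) = n"
  by (auto simp: gamma_Q_def)

text \<open>For \<open>0 < 2 * j < n\<close> the two columns are a cosine and a sine of the same
  frequency, and the addition formula applies; for \<open>2 * j > n\<close> the roles are swapped.
  The columns with \<open>j = 0\<close> and \<open>2 * j = n\<close> are paired with themselves, and
  counting them twice gives the same factor \<open>2 / n\<close>.\<close>

lemma gamma_Q_paired_columns:
  assumes j: "j < n" and k: "k < n" and l: "l < n"
  shows "gamma_Q n $$ (k, j) * gamma_Q n $$ (l, j)
      + gamma_Q n $$ (k, (n - j) mod n) * gamma_Q n $$ (l, (n - j) mod n)
    = 2 / real n * cos (2 * pi * (real k - real l) * real j / real n)"
proof -
  have n: "n > 0" using j by simp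
  have sq: "sqrt (2 / real n) * x * (sqrt (2 / real n) * y) = 2 / real n * (x * y)" for x y
  proof -
    have "sqrt (2 / real n) * x * (sqrt (2 / real n) * y) = (sqrt (2 / real n))\<^sup>2 * (x * y)"
      by (simp only: power2_eq_square mult_ac)
    moreover have "(sqrt (2 / real n))\<^sup>2 = 2 / real n" by simp
    ultimately show ?thesis by (simp only:)
  qed
  have diff: "2 * pi * (real k - real l) * x / real n
      = 2 * pi * real k * x / real n - 2 * pi * real l * x / real n" for x
    by (simp add: diff_divide_distrib algebra_simps)
  consider "j = 0" | "2 * j = n" | "j > 0" "2 * j < n" | "2 * j > n" by linarith
  then show ?thesis
  proof cases
    case 1
    then show ?thesis using k l n by (simp add: gamma_Q_def)
  next
    case 2
    have c: "cos (2 * pi * (real k - real l) * real j / real n) = (- 1) ^ k * (- 1) ^ l"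
    proof -
      have "2 * pi * (real k - real l) * real j / real n = pi * real k - pi * real l"
        using 2 n by (simp add: field_simps flip: 2)
      then show ?thesis by (simp add: cos_diff cos_npi2 mult.commute)
    qed
    have "(n - j) mod n = j" "\<not> j \<le> (n - 1) div 2" "j \<noteq> 0" using 2 n by auto
    then show ?thesis unfolding c using 2 j k l n
      by (simp add: gamma_Q_def)
  next
    case 3
    then have e: "(n - j) mod n = n - j" "j \<le> (n - 1) div 2" "\<not> n - j \<le> (n - 1) div 2"
      "2 * (n - j) \<noteq> n" "n - (n - j) = j" "n - j \<noteq> 0" by auto
    have "gamma_Q n $$ (i, j) = sqrt (2 / real n) * cos (2 * pi * real i * real j / real n)"
      "gamma_Q n $$ (i, n - j) = sqrt (2 / real n) * sin (2 * pi * real i * real j / real n)"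
      if "i < n" for i
      using that e 3 by (simp_all add: gamma_Q_def)
    then show ?thesis using e(1) k l by (simp only: sq diff cos_diff) (simp add: algebra_simps)
  next
    case 4
    then have e: "(n - j) mod n = n - j" "n - j \<le> (n - 1) div 2" "\<not> j \<le> (n - 1) div 2"
      "2 * j \<noteq> n" "j \<noteq> 0" "n - j \<noteq> 0" using j by auto
    have Q: "gamma_Q n $$ (i, j) = sqrt (2 / real n) * sin (2 * pi * real i * real (n - j) / real n)"
      "gamma_Q n $$ (i, n - j) = sqrt (2 / real n) * cos (2 * pi * real i * real (n - j) / real n)"
      if "i < n" for i
      using that e j by (simp_all add: gamma_Q_def)
    \<comment> \<open>Modulo multiples of \<open>2 * pi\<close> the angle for \<open>j\<close> is
      the negative of the angle for \<open>n - j\<close>, and the cosine is even.\<close>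
    have "2 * pi * (real k - real l) * real j / real n
        = 2 * pi * of_int (int k - int l) - 2 * pi * (real k - real l) * real (n - j) / real n"
      using j n by (simp add: field_simps of_nat_diff)
    then have "cos (2 * pi * (real k - real l) * real j / real n)
        = cos (2 * pi * (real k - real l) * real (n - j) / real n)"
      by (simp only: cos_diff cos_int_2pin sin_int_2pin)
    then show ?thesis using e(1) k l by (simp only: Q sq diff cos_diff) (simp add: algebra_simps)
  qed
qed

lemma sum_reflect_index:
  fixes F :: "nat \<Rightarrow> real"
  shows "(\<Sum>j<n. F ((n - j) mod n)) = (\<Sum>j<n. F j)"
proof -
  have inv: "(n - (n - j) mod n) mod n = j" if "j < n" for j
    using that by (cases "j = 0") auto
  show ?thesis
    by (rule sum.reindex_bij_witness[where i = "\<lambda>j. (n - j) mod n" and j = "\<lambda>j. (n - j) mod n"])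
      (auto simp: inv)
qed

text \<open>Averaging the sum with its reflection brings in the paired columns, so only cosines in
  \<open>k - l\<close> remain. This is why symmetric eigenvalue vectors give circulant
  matrices.\<close>

lemma sum_gamma_Q_symmetric:
  assumes k: "k < n" and l: "l < n" and sym: "\<And>j. j < n \<Longrightarrow> c ((n - j) mod n) = c j"
  shows "(\<Sum>j<n. gamma_Q n $$ (k, j) * gamma_Q n $$ (l, j) * c j)
    = (\<Sum>j<n. cos (2 * pi * (real k - real l) * real j / real n) * c j) / real n"
proof -
  let ?q = "\<lambda>j. gamma_Q n $$ (k, j) * gamma_Q n $$ (l, j)"
  let ?F = "\<lambda>j. ?q j * c j"
  have "2 * (\<Sum>j<n. ?F j) = (\<Sum>j<n. ?F j) + (\<Sum>j<n. ?F ((n - j) mod n))"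
    by (simp only: sum_reflect_index[of ?F])
  also have "\<dots> = (\<Sum>j<n. (?q j + ?q ((n - j) mod n)) * c j)"
    unfolding sum.distrib[symmetric] by (intro sum.cong refl) (simp add: sym distrib_right)
  also have "\<dots> = (\<Sum>j<n. 2 / real n * cos (2 * pi * (real k - real l) * real j / real n) * c j)"
    by (intro sum.cong refl) (use k l gamma_Q_paired_columns in simp)
  also have "\<dots> = 2 * ((\<Sum>j<n. cos (2 * pi * (real k - real l) * real j / real n) * c j) / real n)"
    by (simp add: sum_distrib_left sum_divide_distrib mult_ac)
  finally show ?thesis by simp
qed

text \<open>The entries of the first product have the symmetric weight 1, hence are averages of
  equidistributed cosines, which vanish off the diagonal because \<open>k - l\<close> is then not
  divisible by \<open>n\<close>. The second product follows for square matrices.\<close>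

lemma gamma_Q_orthogonal:
  "gamma_Q n * transpose_mat (gamma_Q n) = 1\<^sub>m n"
  "transpose_mat (gamma_Q n) * gamma_Q n = 1\<^sub>m n"
proof -
  show *: "gamma_Q n * transpose_mat (gamma_Q n) = 1\<^sub>m n"
  proof (rule eq_matI)
    fix k l assume "k < dim_row (1\<^sub>m n :: real mat)" "l < dim_col (1\<^sub>m n :: real mat)"
    then have kl: "k < n" "l < n" by auto
    then have n: "n > 0" by simp
    have "(gamma_Q n * transpose_mat (gamma_Q n)) $$ (k, l)
        = (\<Sum>j<n. gamma_Q n $$ (k, j) * gamma_Q n $$ (l, j) * 1)"
      using kl by (subst index_mult_mat_sum[of _ n n _ n]) auto
    also have "\<dots> = (\<Sum>j<n. cos (2 * pi * real_of_int (int k - int l) * real j / real n)) / real n"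
      using kl by (subst sum_gamma_Q_symmetric) auto
    also have "\<dots> = (if int n dvd int k - int l then 1 else 0)"
      using n by (subst sum_cos_equidistributed) auto
    also have "int n dvd int k - int l \<longleftrightarrow> k = l"
      using kl by (metis mod_eq_dvd_iff nat_int mod_less zmod_int)
    finally show "(gamma_Q n * transpose_mat (gamma_Q n)) $$ (k, l) = 1\<^sub>m n $$ (k, l)"
      using kl by simp
  qed auto
  show "transpose_mat (gamma_Q n) * gamma_Q n = 1\<^sub>m n"
    by (rule mat_mult_left_right_inverse[OF _ _ *]) auto
qed

lemma gamma_Q_columns_orthonormal:
  assumes "i < n" "j < n"
  shows "(\<Sum>k<n. gamma_Q n $$ (k, i) * gamma_Q n $$ (k, j)) = (if i = j then 1 else 0)"
proof -
  have "(transpose_mat (gamma_Q n) * gamma_Q n) $$ (i, j)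
      = (\<Sum>k<n. gamma_Q n $$ (k, i) * gamma_Q n $$ (k, j))"
    using assms by (subst index_mult_mat_sum[of _ n n _ n]) auto
  then show ?thesis using assms by (simp add: gamma_Q_orthogonal)
qed

text \<open>Flatness of the columns is what limits the effect of a fixed number of corner entries on
  a Rayleigh quotient to order \<open>1 / n\<close>.\<close>

lemma gamma_Q_entry_sq_le: "(gamma_Q n $$ (k, j))\<^sup>2 \<le> 2 / real n" if "k < n" "j < n"
proof -
  have sq: "(x / sqrt (real n))\<^sup>2 \<le> 2 / real n" "(sqrt (2 / real n) * x)\<^sup>2 \<le> 2 / real n"
    if "x\<^sup>2 \<le> 1" for x :: real
  proof -
    have "(x / sqrt (real n))\<^sup>2 = x\<^sup>2 / real n" "(sqrt (2 / real n) * x)\<^sup>2 = 2 / real n * x\<^sup>2"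
      by (simp_all add: power_divide power_mult_distrib)
    moreover have "x\<^sup>2 / real n \<le> 2 / real n" "2 / real n * x\<^sup>2 \<le> 2 / real n * 1"
      using that by (intro divide_right_mono mult_left_mono; simp)+
    ultimately show "(x / sqrt (real n))\<^sup>2 \<le> 2 / real n" "(sqrt (2 / real n) * x)\<^sup>2 \<le> 2 / real n"
      by linarith+
  qed
  have one: "((- 1) ^ k :: real)\<^sup>2 \<le> 1" by (simp flip: power_mult)
  have cs: "(cos x)\<^sup>2 \<le> 1" "(sin x)\<^sup>2 \<le> 1" for x :: real
    by (simp_all add: abs_square_le_1)
  have "(1 :: real)\<^sup>2 \<le> 1" by simp
  note sq = sq(1)[OF this] sq(1)[OF one] sq(2)[OF cs(1)] sq(2)[OF cs(2)]
  have "gamma_Q n $$ (k, j) = (if j = 0 then 1 / sqrt (real n)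
     else if j \<le> (n - 1) div 2 then sqrt (2 / real n) * cos (2 * pi * real k * real j / real n)
     else if 2 * j = n then (- 1) ^ k / sqrt (real n)
     else sqrt (2 / real n) * sin (2 * pi * real k * real (n - j) / real n))"
    using that by (simp add: gamma_Q_def)
  then show ?thesis by (simp only: sq split: if_split) simp
qed

section \<open>Matrices of the gamma algebra\<close>

lemma gamma_mat_carrier [simp]: "gamma_mat n v \<in> carrier_mat n n"
  and gamma_mat_dim [simp]: "dim_row (gamma_mat n v) = n" "dim_col (gamma_mat n v) = n"
  by (auto simp: gamma_mat_def)

lemma gamma_mat_index:
  assumes "k < n" "l < n"
  shows "gamma_mat n v $$ (k, l) = (\<Sum>j<n. gamma_Q n $$ (k, j) * gamma_Q n $$ (l, j) * v $ j)"
proof -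
  have "gamma_mat n v $$ (k, l)
      = (\<Sum>j<n. (gamma_Q n * mat_diag n (\<lambda>j. v $ j)) $$ (k, j) * transpose_mat (gamma_Q n) $$ (j, l))"
    unfolding gamma_mat_def using assms by (intro index_mult_mat_sum[of _ n n _ n]) auto
  also have "\<dots> = (\<Sum>j<n. gamma_Q n $$ (k, j) * gamma_Q n $$ (l, j) * v $ j)"
    using assms by (intro sum.cong refl) (simp add: mat_diag_mult_right[of _ n n] mult_ac)
  finally show ?thesis .
qed

text \<open>Column \<open>j\<close> is a unit eigenvector, so its Rayleigh quotient returns the
  eigenvalue. This serves both the orthogonality behind the minimiser and the comparison of Rayleigh
  quotients with the sampled symbol.\<close>

lemma gamma_mat_form:
  assumes j: "j < n"
  shows "(\<Sum>k<n. \<Sum>l<n. gamma_Q n $$ (k, j) * gamma_mat n v $$ (k, l) * gamma_Q n $$ (l, j)) = v $ j"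
proof -
  let ?q = "\<lambda>k i. gamma_Q n $$ (k, i)"
  have "(\<Sum>k<n. \<Sum>l<n. ?q k j * gamma_mat n v $$ (k, l) * ?q l j)
      = (\<Sum>k<n. \<Sum>l<n. \<Sum>i<n. (?q k j * ?q k i) * ((?q l i * ?q l j) * v $ i))"
    by (intro sum.cong refl) (simp add: gamma_mat_index sum_distrib_left sum_distrib_right mult_ac)
  also have "\<dots> = (\<Sum>k<n. \<Sum>i<n. \<Sum>l<n. (?q k j * ?q k i) * ((?q l i * ?q l j) * v $ i))"
    by (intro sum.cong refl sum.swap)
  also have "\<dots> = (\<Sum>k<n. \<Sum>i<n. (?q k j * ?q k i) * ((\<Sum>l<n. ?q l i * ?q l j) * v $ i))"
    by (simp add: sum_distrib_left sum_distrib_right)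
  also have "\<dots> = (\<Sum>k<n. \<Sum>i<n. if i = j then (?q k j * ?q k j) * v $ j else 0)"
    using j by (intro sum.cong refl) (simp add: gamma_Q_columns_orthonormal)
  also have "\<dots> = (\<Sum>k<n. ?q k j * ?q k j) * v $ j"
    using j by (simp add: sum_distrib_right)
  finally show ?thesis using j by (simp add: gamma_Q_columns_orthonormal)
qed

text \<open>Aliasing: samples at the points \<open>2 * pi * j / n\<close> cannot separate
  frequencies that agree modulo \<open>n\<close>, so \<open>t m\<close> is wrapped onto every
  diagonal on which \<open>k - l\<close> is congruent to \<open>m\<close>.\<close>

lemma gamma_mat_trig_poly_index:
  fixes t :: "int \<Rightarrow> real" and K :: nat
  assumes even_t: "\<And>m. t (- m) = t m" and k: "k < n" and l: "l < n"
  shows "gamma_mat n (vec n (\<lambda>j. \<Sum>m=-int K..int K. t m * cos (of_int m * (2 * pi * real j / real n)))) $$ (k, l)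
    = (\<Sum>m=-int K..int K. if int n dvd int k - int l - m then t m else 0)"
proof -
  define c where "c j = (\<Sum>m=-int K..int K. t m * cos (of_int m * (2 * pi * real j / real n)))" for j
  define a where "a = int k - int l"
  let ?I = "{-int K..int K}"
  have n: "n > 0" using k by simp
  have sym: "c ((n - j) mod n) = c j" if "j < n" for j
  proof (cases "j = 0")
    case False
    then have "(n - j) mod n = n - j" using that by simp
    moreover have "cos (of_int m * (2 * pi * real (n - j) / real n)) = cos (of_int m * (2 * pi * real j / real n))"
      for m :: int
    proof -
      have "of_int m * (2 * pi * real (n - j) / real n)
          = 2 * pi * of_int m - of_int m * (2 * pi * real j / real n)"
        using that n by (simp add: field_simps of_nat_diff)
      then show ?thesis by (simp add: cos_diff)
    qed
    ultimately show ?thesis by (simp add: c_def)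
  qed simp
  \<comment> \<open>The product-to-sum formula yields two equidistributed cosine sums, with
    frequencies \<open>a - m\<close> and \<open>a + m\<close>.\<close>
  have orth: "(\<Sum>j<n. cos (2 * pi * of_int a * real j / real n) * cos (of_int m * (2 * pi * real j / real n)))
      = ((if int n dvd a - m then real n else 0) + (if int n dvd a + m then real n else 0)) / 2" for m
  proof -
    have "(\<Sum>j<n. cos (2 * pi * of_int a * real j / real n) * cos (of_int m * (2 * pi * real j / real n)))
      = (\<Sum>j<n. (cos (2 * pi * of_int (a - m) * real j / real n) + cos (2 * pi * of_int (a + m) * real j / real n)) / 2)"
    proof (intro sum.cong refl)
      fix j
      have "2 * pi * of_int a * real j / real n - of_int m * (2 * pi * real j / real n)
          = 2 * pi * of_int (a - m) * real j / real n"
        "2 * pi * of_int a * real j / real n + of_int m * (2 * pi * real j / real n)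
          = 2 * pi * of_int (a + m) * real j / real n"
        using n by (simp_all add: field_simps)
      then show "cos (2 * pi * of_int a * real j / real n) * cos (of_int m * (2 * pi * real j / real n))
        = (cos (2 * pi * of_int (a - m) * real j / real n) + cos (2 * pi * of_int (a + m) * real j / real n)) / 2"
        by (simp only: cos_times_cos)
    qed
    then show ?thesis
      by (simp only: sum_divide_distrib[symmetric] sum.distrib sum_cos_equidistributed[OF n])
  qed
  have "gamma_mat n (vec n c) $$ (k, l) = (\<Sum>j<n. gamma_Q n $$ (k, j) * gamma_Q n $$ (l, j) * c j)"
    using k l by (simp add: gamma_mat_index)
  also have "\<dots> = (\<Sum>j<n. cos (2 * pi * of_int a * real j / real n) * c j) / real n"
    using sum_gamma_Q_symmetric[of k n l c] k l sym by (simp add: a_def)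
  also have "(\<Sum>j<n. cos (2 * pi * of_int a * real j / real n) * c j)
      = (\<Sum>m\<in>?I. t m * (\<Sum>j<n. cos (2 * pi * of_int a * real j / real n) * cos (of_int m * (2 * pi * real j / real n))))"
    unfolding c_def sum_distrib_left by (subst sum.swap) (simp only: mult.left_commute)
  also have "\<dots> = (\<Sum>m\<in>?I. real n / 2 * (if int n dvd a - m then t m else 0)
      + real n / 2 * (if int n dvd a + m then t m else 0))"
    unfolding orth by (intro sum.cong refl) (simp add: algebra_simps)
  also have "\<dots> = real n / 2 * ((\<Sum>m\<in>?I. if int n dvd a - m then t m else 0)
      + (\<Sum>m\<in>?I. if int n dvd a + m then t m else 0))"
    by (simp only: sum.distrib sum_distrib_left[symmetric] distrib_left)
  \<comment> \<open>Evenness of \<open>t\<close> makes the two contributions equal, which absorbs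
    the factor 1/2.\<close>
  also have "(\<Sum>m\<in>?I. if int n dvd a + m then t m else 0) = (\<Sum>m\<in>?I. if int n dvd a - m then t m else 0)"
    by (rule sum.reindex_bij_witness[where i = uminus and j = uminus]) (auto simp: even_t)
  finally have "gamma_mat n (vec n c) $$ (k, l) = (\<Sum>m\<in>?I. if int n dvd a - m then t m else 0)"
    using n by simp
  then show ?thesis by (simp add: c_def[abs_def] a_def)
qed

text \<open>No wrap-around: \<open>a - m\<close> is smaller than \<open>n\<close> in absolute value
  for every \<open>m\<close> in the band, so divisibility forces \<open>m = a\<close>.\<close>

lemma wrapped_coefficients_inside_band:
  fixes t :: "int \<Rightarrow> real"
  assumes "\<bar>a\<bar> + int K < int n"
  shows "(\<Sum>m=-int K..int K. if int n dvd a - m then t m else 0) = (if \<bar>a\<bar> \<le> int K then t a else 0)"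
proof -
  have "int n dvd a - m \<longleftrightarrow> m = a" if "m \<in> {-int K..int K}" for m
  proof
    assume "int n dvd a - m"
    moreover have "\<bar>a - m\<bar> < int n" using assms that by auto
    ultimately show "m = a" using dvd_imp_le_int[of "a - m" "int n"] by auto
  qed simp
  then have "(\<Sum>m=-int K..int K. if int n dvd a - m then t m else 0)
      = (\<Sum>m=-int K..int K. if m = a then t a else 0)"
    by (intro sum.cong) auto
  then show ?thesis by auto
qed

subsection \<open>Low-rank perturbation of a preconditioned matrix\<close>

text \<open>Cauchy-Schwarz after splitting the modulus of each entry into two square roots: row sums
  bound the first factor, and column sums bound the second once the order of summation is
  exchanged.\<close>

lemma schur_test:
  fixes E :: "nat \<Rightarrow> nat \<Rightarrow> real"
  assumes row: "\<And>k. k < n \<Longrightarrow> (\<Sum>l<n. \<bar>E k l\<bar>) \<le> \<delta>"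
    and col: "\<And>l. l < n \<Longrightarrow> (\<Sum>k<n. \<bar>E k l\<bar>) \<le> \<delta>" and \<delta>: "\<delta> \<ge> 0"
  shows "(\<Sum>k<n. (\<Sum>l<n. E k l * x l)\<^sup>2) \<le> \<delta>\<^sup>2 * (\<Sum>l<n. (x l)\<^sup>2)"
proof -
  have "(\<Sum>l<n. E k l * x l)\<^sup>2 \<le> \<delta> * (\<Sum>l<n. \<bar>E k l\<bar> * (x l)\<^sup>2)" if k: "k < n" for k
  proof -
    have "(\<Sum>l<n. E k l * x l) = (\<Sum>l<n. sqrt \<bar>E k l\<bar> * (sgn (E k l) * sqrt \<bar>E k l\<bar> * x l))"
    proof (intro sum.cong refl)
      fix l
      have "sqrt \<bar>E k l\<bar> * (sgn (E k l) * sqrt \<bar>E k l\<bar> * x l)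
          = (sqrt \<bar>E k l\<bar> * sqrt \<bar>E k l\<bar>) * sgn (E k l) * x l" by (simp only: mult_ac)
      also have "\<dots> = (\<bar>E k l\<bar> * sgn (E k l)) * x l"
        by (simp only: real_sqrt_mult_self abs_idempotent)
      finally show "E k l * x l = sqrt \<bar>E k l\<bar> * (sgn (E k l) * sqrt \<bar>E k l\<bar> * x l)"
        by (simp only: abs_mult_sgn)
    qed
    then have "(\<Sum>l<n. E k l * x l)\<^sup>2
        \<le> (\<Sum>l<n. (sqrt \<bar>E k l\<bar>)\<^sup>2) * (\<Sum>l<n. (sgn (E k l) * sqrt \<bar>E k l\<bar> * x l)\<^sup>2)"
      by (simp only: Cauchy_Schwarz_ineq_sum)
    also have "(\<Sum>l<n. (sgn (E k l) * sqrt \<bar>E k l\<bar> * x l)\<^sup>2) = (\<Sum>l<n. \<bar>E k l\<bar> * (x l)\<^sup>2)"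
      by (intro sum.cong refl) (auto simp: power_mult_distrib sgn_if)
    also have "(\<Sum>l<n. (sqrt \<bar>E k l\<bar>)\<^sup>2) = (\<Sum>l<n. \<bar>E k l\<bar>)" by simp
    also have "(\<Sum>l<n. \<bar>E k l\<bar>) * (\<Sum>l<n. \<bar>E k l\<bar> * (x l)\<^sup>2) \<le> \<delta> * (\<Sum>l<n. \<bar>E k l\<bar> * (x l)\<^sup>2)"
      by (intro mult_right_mono row k sum_nonneg) auto
    finally show ?thesis .
  qed
  then have "(\<Sum>k<n. (\<Sum>l<n. E k l * x l)\<^sup>2) \<le> (\<Sum>k<n. \<delta> * (\<Sum>l<n. \<bar>E k l\<bar> * (x l)\<^sup>2))"
    by (intro sum_mono) auto
  also have "\<dots> = \<delta> * (\<Sum>l<n. (\<Sum>k<n. \<bar>E k l\<bar>) * (x l)\<^sup>2)"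
    unfolding sum_distrib_left[symmetric] sum_distrib_right by (subst sum.swap) simp
  also have "\<dots> \<le> \<delta> * (\<Sum>l<n. \<delta> * (x l)\<^sup>2)"
    by (intro mult_left_mono sum_mono mult_right_mono col \<delta>) auto
  also have "\<dots> = \<delta>\<^sup>2 * (\<Sum>l<n. (x l)\<^sup>2)"
    by (simp add: sum_distrib_left power2_eq_square mult.assoc)
  finally show ?thesis .
qed

lemma quadratic_form_le:
  fixes E :: "nat \<Rightarrow> nat \<Rightarrow> real"
  assumes E: "(\<Sum>k<n. (\<Sum>l<n. E k l * x l)\<^sup>2) \<le> \<delta>\<^sup>2 * (\<Sum>l<n. (x l)\<^sup>2)" and \<delta>: "\<delta> \<ge> 0"
  shows "\<bar>\<Sum>k<n. \<Sum>l<n. x k * E k l * x l\<bar> \<le> \<delta> * (\<Sum>l<n. (x l)\<^sup>2)"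
proof (rule power2_le_imp_le)
  have "\<bar>\<Sum>k<n. \<Sum>l<n. x k * E k l * x l\<bar>\<^sup>2 = (\<Sum>k<n. x k * (\<Sum>l<n. E k l * x l))\<^sup>2"
    by (simp add: sum_distrib_left mult.assoc)
  also have "\<dots> \<le> (\<Sum>k<n. (x k)\<^sup>2) * (\<Sum>k<n. (\<Sum>l<n. E k l * x l)\<^sup>2)"
    by (rule Cauchy_Schwarz_ineq_sum)
  also have "\<dots> \<le> (\<Sum>k<n. (x k)\<^sup>2) * (\<delta>\<^sup>2 * (\<Sum>l<n. (x l)\<^sup>2))"
    by (intro mult_left_mono E sum_nonneg) auto
  finally show "\<bar>\<Sum>k<n. \<Sum>l<n. x k * E k l * x l\<bar>\<^sup>2 \<le> (\<delta> * (\<Sum>l<n. (x l)\<^sup>2))\<^sup>2"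
    by (simp add: power_mult_distrib power2_eq_square mult_ac)
  show "0 \<le> \<delta> * (\<Sum>l<n. (x l)\<^sup>2)" using \<delta> by (intro mult_nonneg_nonneg sum_nonneg) auto
qed

lemma mat_diag_cong: "(\<And>i. i < n \<Longrightarrow> f i = g i) \<Longrightarrow> mat_diag n f = mat_diag n g"
  by (rule eq_matI) (auto simp: mat_diag_def)

text \<open>\<open>inv_mat\<close> extracts a value from an option, so \<open>mat_inverse\<close>
  must first be shown to return one; uniqueness of inverses then identifies it with
  \<open>B\<close>.\<close>

lemma inv_mat_eq:
  fixes A B :: "real mat"
  assumes A: "A \<in> carrier_mat n n" and B: "B \<in> carrier_mat n n" and AB: "A * B = 1\<^sub>m n"
  shows "inv_mat A = B" "invertible_mat A"
proof -
  have BA: "B * A = 1\<^sub>m n" by (rule mat_mult_left_right_inverse[OF A B AB])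
  then show "invertible_mat A" using A B AB
    by (auto simp: invertible_mat_def inverts_mat_def intro!: exI[of _ B])
  have "A \<in> Units (ring_mat TYPE(real) n ())"
    using A B AB BA by (auto simp: Units_def ring_mat_def)
  then obtain B' where B': "mat_inverse A = Some B'" using mat_inverse(1)[OF A] by fastforce
  then have *: "B' * A = 1\<^sub>m n" "B' \<in> carrier_mat n n" using mat_inverse(2)[OF A] by auto
  have "B' = B' * (A * B)" using * AB by simp
  also have "\<dots> = B' * A * B" by (simp only: assoc_mult_mat[OF *(2) A B])
  also have "\<dots> = B" unfolding *(1) using B by simp
  finally show "inv_mat A = B" by (simp add: inv_mat_def B')
qed

text \<open>Scaling by \<open>h\<^sub>j = \<bar>\<tau>\<^sub>j\<bar> powr (-1/2)\<close> makes the nonsymmetric \<open>P\<^sup>-\<^sup>1 T\<close> similar to the symmetric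
  \<open>s diag(h) Q\<^sup>T T Q diag(h)\<close>, where \<open>s\<close> is the common sign of the \<open>\<tau>\<^sub>j\<close>.\<close>

theorem preconditioned_eigenvalue_count:
  fixes P Q T :: "real mat" and \<tau> :: "nat \<Rightarrow> real"
  assumes P_def: "P = Q * mat_diag n \<tau> * transpose_mat Q"
    and Q: "Q \<in> carrier_mat n n" and QQ: "transpose_mat Q * Q = 1\<^sub>m n"
    and T: "T \<in> carrier_mat n n" and symT: "transpose_mat T = T"
    and s: "s * s = 1" and a: "a > 0" and \<tau>: "\<And>j. j < n \<Longrightarrow> s * \<tau> j \<ge> a"
    and F: "finite F"
    and TP: "\<And>k l. k < n \<Longrightarrow> l < n \<Longrightarrow> T $$ (k, l) = P $$ (k, l) + R k l + E k l"
    and R: "\<And>k l. k < n \<Longrightarrow> k \<notin> F \<Longrightarrow> R k l = 0"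
    and E: "\<And>y. (\<Sum>k<n. (\<Sum>l<n. E k l * y l)\<^sup>2) \<le> \<eta>\<^sup>2 * (\<Sum>l<n. (y l)\<^sup>2)" and \<eta>: "\<eta> \<ge> 0"
  shows "invertible_mat P"
    and "size {#\<mu> \<in># eigenvalue_mset (inv_mat P * T). cmod (\<mu> - 1) > \<eta> / a#} \<le> card F"
proof -
  let ?D = "mat_diag n" and ?Qt = "transpose_mat Q"
  note am = assoc_mult_mat[of _ n n _ n _ n] mult_carrier_mat[of _ n n _ n]
    and amv = assoc_mult_mat_vec[of _ n n _ n]
  have Qt: "?Qt \<in> carrier_mat n n" using Q by simp
  have QQ': "Q * ?Qt = 1\<^sub>m n" by (rule mat_mult_left_right_inverse[OF Qt Q QQ])
  have QtQ: "?Qt * (Q * X) = X" if "X \<in> carrier_mat n n" for X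
    using that by (simp only: assoc_mult_mat[OF Qt Q that, symmetric] QQ left_mult_one_mat)
  have DD: "?D f * (?D g * X) = ?D (\<lambda>i. f i * g i) * X" if "X \<in> carrier_mat n n" for f g X
    using that by (simp add: am(1)[symmetric] del: assoc_mult_mat)
  have P: "P \<in> carrier_mat n n" using Q unfolding P_def carrier_mat_def by simp
  define Pinv where "Pinv = Q * ?D (\<lambda>j. 1 / \<tau> j) * ?Qt"
  have Pinv: "Pinv \<in> carrier_mat n n" using Q unfolding Pinv_def carrier_mat_def by simp
  have st: "s * \<tau> j > 0" "\<tau> j \<noteq> 0" if "j < n" for j
    using \<tau>[OF that] a by auto
  have one: "?D f = 1\<^sub>m n" if "\<And>i. i < n \<Longrightarrow> f i = 1" for f :: "nat \<Rightarrow> real"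
    using mat_diag_cong[of n f "\<lambda>_. 1"] that by simp
  have PPinv: "P * Pinv = 1\<^sub>m n"
  proof -
    have "P * Pinv = Q * (?D (\<lambda>j. \<tau> j * (1 / \<tau> j)) * ?Qt)"
      unfolding P_def Pinv_def using Q by (simp add: am QtQ DD)
    also have "\<dots> = 1\<^sub>m n" using Q st(2) QQ' by (subst one) auto
    finally show ?thesis .
  qed
  note inv = inv_mat_eq[OF P Pinv PPinv]
  show "invertible_mat P" by (rule inv)
  define h where "h j = 1 / sqrt (s * \<tau> j)" for j
  have h0: "h j > 0" if "j < n" for j using st(1)[OF that] by (simp add: h_def)
  have hh: "(h j)\<^sup>2 = 1 / (s * \<tau> j)" if "j < n" for j
    using st(1)[OF that] by (simp add: h_def power_divide)
  have h\<tau>: "s * h j * \<tau> j * h j = 1" if "j < n" for j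
  proof -
    have "s * h j * \<tau> j * h j = s * \<tau> j * (h j)\<^sup>2" by (simp add: power2_eq_square)
    then show ?thesis using hh[OF that] st(1)[OF that] by auto
  qed
  have hinv: "h j * (s * h j) = 1 / \<tau> j" if "j < n" for j
    using h\<tau>[OF that] st(2)[OF that] by (simp add: eq_divide_eq mult_ac)
  have ha: "(h j)\<^sup>2 \<le> 1 / a" if "j < n" for j
    using hh[OF that] \<tau>[OF that] a by (simp add: frac_le)
  define W where "W = ?Qt * T * Q"
  have W: "W \<in> carrier_mat n n" using Q T unfolding W_def carrier_mat_def by simp
  have symW: "transpose_mat W = W"
    unfolding W_def using Q T by (simp add: transpose_mult[of _ n n _ n] symT am)
  define S where "S = ?D (\<lambda>j. s * h j) * W * ?D h"
  have S: "S \<in> carrier_mat n n" using W unfolding S_def carrier_mat_def by simp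
  have Sij: "S $$ (i, j) = s * h i * W $$ (i, j) * h j" if "i < n" "j < n" for i j
    unfolding S_def using W that
    by (simp add: mat_diag_mult_right[of _ n n] mat_diag_mult_left[of _ n n] del: assoc_mult_mat)
  have symS: "transpose_mat S = S"
  proof (rule eq_matI)
    fix i j assume "i < dim_row S" "j < dim_col S"
    then have ij: "i < n" "j < n" using S by auto
    have "W $$ (j, i) = W $$ (i, j)" using symW W ij by (metis carrier_matD index_transpose_mat(1))
    then show "transpose_mat S $$ (i, j) = S $$ (i, j)" using S ij by (simp add: Sij)
  qed (use S in auto)
  \<comment> \<open>The outer scalings multiply to \<open>h j * (s * h j) = 1 / \<tau> j\<close>,
    which rebuilds the diagonal of \<open>Pinv\<close>; the inner ones cancel.\<close>
  have "similar_mat_wit (Pinv * T) S (Q * ?D h) (?D (\<lambda>j. 1 / h j) * ?Qt)"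
  proof -
    have "(Q * ?D h) * (?D (\<lambda>j. 1 / h j) * ?Qt) = Q * (?D (\<lambda>j. h j * (1 / h j)) * ?Qt)"
      using Q by (simp add: am DD)
    also have "\<dots> = 1\<^sub>m n" using Q h0 QQ' by (subst one) (auto simp: less_le)
    finally have 1: "(Q * ?D h) * (?D (\<lambda>j. 1 / h j) * ?Qt) = 1\<^sub>m n" .
    have 2: "(?D (\<lambda>j. 1 / h j) * ?Qt) * (Q * ?D h) = 1\<^sub>m n"
      using Q by (intro mat_mult_left_right_inverse[OF _ _ 1]) auto
    have "(Q * ?D h) * S * (?D (\<lambda>j. 1 / h j) * ?Qt)
        = Q * (?D (\<lambda>j. h j * (s * h j)) * (?Qt * (T * (Q * (?D (\<lambda>j. h j * (1 / h j)) * ?Qt)))))"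
      unfolding S_def W_def using Q T by (simp add: am DD)
    also have "?D (\<lambda>j. h j * (1 / h j)) = 1\<^sub>m n" using h0 by (intro one) (auto simp: less_le)
    also have "?D (\<lambda>j. h j * (s * h j)) = ?D (\<lambda>j. 1 / \<tau> j)" using hinv by (rule mat_diag_cong)
    also have "Q * (?D (\<lambda>j. 1 / \<tau> j) * (?Qt * (T * (Q * (1\<^sub>m n * ?Qt))))) = Pinv * T"
      unfolding Pinv_def using Q T QQ' by (simp add: am)
    finally show ?thesis using 1 2 Pinv S Q T by (simp add: similar_mat_wit_def Let_def am)
  qed
  then have spec: "eigenvalue_mset (inv_mat P * T) = eigenvalue_mset S"
    unfolding inv(1) by (intro eigenvalue_mset_similar) (auto simp: similar_mat_def)
  obtain e where e: "bij_betw e {..<card F} F"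
    using ex_bij_betw_nat_finite[OF F] unfolding lessThan_atLeast0 by blast
  \<comment> \<open>The rows of \<open>R\<close> with index in \<open>F\<close>, in the coordinates
    of \<open>S\<close>: if \<open>Y\<close> annihilates \<open>x\<close>, then \<open>R\<close>
    annihilates the vector \<open>y\<close> obtained from \<open>x\<close> by scaling with
    \<open>h\<close> and applying \<open>Q\<close>.\<close>
  define Y where "Y = mat (card F) n (\<lambda>(b, i). \<Sum>l<n. R (e b) l * (Q $$ (l, i) * h i))"
  have Y: "Y \<in> carrier_mat (card F) n" by (simp add: Y_def)
  have "size {#\<mu> \<in># eigenvalue_mset S. cmod (\<mu> - complex_of_real 1) > \<eta> / a#} \<le> card F"
  proof (rule eigenvalue_count_le[OF S symS Y])
    show "\<eta> / a \<ge> 0" using \<eta> a by simp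
    fix x :: "real vec" assume x: "x \<in> carrier_vec n" and Yx: "Y *\<^sub>v x = 0\<^sub>v (card F)"
    define hx where "hx = ?D h *\<^sub>v x"
    have hx: "hx \<in> carrier_vec n" by (simp add: hx_def carrier_vecI mat_diag_def)
    have hxi: "hx $ i = h i * x $ i" if "i < n" for i
      unfolding hx_def by (rule index_mat_diag_mult_vec[OF x that])
    define y where "y = Q *\<^sub>v hx"
    have y: "y \<in> carrier_vec n" using Q hx by (simp add: y_def)
    have yl: "y $ l = (\<Sum>i<n. Q $$ (l, i) * h i * x $ i)" if "l < n" for l
      unfolding y_def using index_mult_mat_vec_sum[OF Q hx that] by (simp add: hxi mult.assoc)
    have Ry: "(\<Sum>l<n. R k l * y $ l) = 0" if k: "k < n" for k
    proof (cases "k \<in> F")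
      case True
      then obtain b where b: "b < card F" "e b = k"
        using e unfolding bij_betw_def by (metis imageE lessThan_iff)
      have "(\<Sum>l<n. R k l * y $ l) = (\<Sum>l<n. \<Sum>i<n. R k l * (Q $$ (l, i) * h i) * x $ i)"
        by (simp add: yl sum_distrib_left mult.assoc)
      also have "\<dots> = (\<Sum>i<n. (\<Sum>l<n. R k l * (Q $$ (l, i) * h i)) * x $ i)"
        by (subst sum.swap) (simp add: sum_distrib_right)
      also have "\<dots> = (\<Sum>i<n. Y $$ (b, i) * x $ i)"
        using b by (intro sum.cong refl) (simp add: Y_def)
      also have "\<dots> = (Y *\<^sub>v x) $ b"
        by (rule index_mult_mat_vec_sum[OF Y x b(1), symmetric])
      finally show ?thesis using Yx b by simp
    qed (simp add: R k)
    define z where "z = vec n (\<lambda>k. \<Sum>l<n. E k l * y $ l)"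
    have z: "z \<in> carrier_vec n" by (simp add: z_def)
    have Ty: "T *\<^sub>v y = P *\<^sub>v y + z"
    proof (rule eq_vecI)
      fix k assume "k < dim_vec (P *\<^sub>v y + z)"
      then have k: "k < n" using z by simp
      have "(T *\<^sub>v y) $ k = (\<Sum>l<n. P $$ (k, l) * y $ l) + (\<Sum>l<n. R k l * y $ l) + (\<Sum>l<n. E k l * y $ l)"
        unfolding index_mult_mat_vec_sum[OF T y k]
        by (simp add: TP k sum.distrib[symmetric] algebra_simps)
      then show "(T *\<^sub>v y) $ k = (P *\<^sub>v y + z) $ k"
        using k P by (simp add: Ry index_mult_mat_vec_sum[OF P y k, symmetric] z_def
            del: index_mult_mat_vec)
    qed (use T P z in auto)
    define u where "u = ?Qt *\<^sub>v z"
    have u: "u \<in> carrier_vec n" using Qt z by (simp add: u_def)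
    have QtP: "?Qt *\<^sub>v (P *\<^sub>v y) = ?D \<tau> *\<^sub>v hx"
    proof -
      have "?Qt *\<^sub>v (P *\<^sub>v y) = (?Qt * P * Q) *\<^sub>v hx"
        using Q P hx unfolding y_def by (simp add: am amv)
      also have "?Qt * P * Q = ?D \<tau>"
        unfolding P_def using Q QQ by (simp add: am QtQ)
      finally show ?thesis .
    qed
    \<comment> \<open>Since \<open>s * h i * \<tau> i * h i = 1\<close>, the contribution of
      \<open>P\<close> is the identity; what remains is \<open>u\<close>, the rotated image of the
      small part \<open>E\<close>.\<close>
    have Sx: "(S *\<^sub>v x) $ i = x $ i + s * h i * u $ i" if i: "i < n" for i
    proof -
      have "S *\<^sub>v x = ?D (\<lambda>j. s * h j) *\<^sub>v (?Qt *\<^sub>v (T *\<^sub>v y))"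
        using Q T x hx unfolding S_def W_def y_def hx_def by (simp add: am amv)
      also have "?Qt *\<^sub>v (T *\<^sub>v y) = ?D \<tau> *\<^sub>v hx + u"
        unfolding Ty u_def QtP[symmetric] using Qt P y z by (intro mult_add_distrib_mat_vec) auto
      also have "(?D (\<lambda>j. s * h j) *\<^sub>v (?D \<tau> *\<^sub>v hx + u)) $ i = s * h i * (\<tau> i * (h i * x $ i) + u $ i)"
        using i u hx mult_mat_vec_carrier[OF mat_diag_dim hx]
        by (simp add: index_mat_diag_mult_vec[of _ n] hxi del: index_mult_mat_vec)
      also have "\<dots> = (s * h i * \<tau> i * h i) * x $ i + s * h i * u $ i" by (simp add: algebra_simps)
      finally show ?thesis by (simp add: h\<tau>[OF i])
    qed
    have weight: "(\<Sum>i<n. (h i)\<^sup>2 * (v $ i)\<^sup>2) \<le> 1 / a * (\<Sum>i<n. (v $ i)\<^sup>2)" for v :: "real vec"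
      unfolding sum_distrib_left by (intro sum_mono mult_right_mono ha) auto
    have "(\<Sum>i<n. (y $ i)\<^sup>2) = (\<Sum>i<n. (h i)\<^sup>2 * (x $ i)\<^sup>2)"
      unfolding y_def orthogonal_mat_norm[OF Q QQ hx] by (simp add: hxi power_mult_distrib)
    then have yx: "(\<Sum>i<n. (y $ i)\<^sup>2) \<le> 1 / a * (\<Sum>i<n. (x $ i)\<^sup>2)"
      using weight[of x] by (simp only:)
    have "(\<Sum>i<n. (u $ i)\<^sup>2) = (\<Sum>i<n. (z $ i)\<^sup>2)"
      unfolding u_def by (rule orthogonal_mat_norm[OF Qt _ z]) (simp add: QQ')
    also have "\<dots> \<le> \<eta>\<^sup>2 * (\<Sum>i<n. (y $ i)\<^sup>2)"
      using E[of "\<lambda>l. y $ l"] by (simp add: z_def)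
    also have "\<dots> \<le> \<eta>\<^sup>2 * (1 / a * (\<Sum>i<n. (x $ i)\<^sup>2))"
      by (rule mult_left_mono[OF yx]) simp
    finally have uu: "(\<Sum>i<n. (u $ i)\<^sup>2) \<le> \<eta>\<^sup>2 * (1 / a * (\<Sum>i<n. (x $ i)\<^sup>2))" .
    have "((S *\<^sub>v x) $ i - 1 * x $ i)\<^sup>2 = (h i)\<^sup>2 * (u $ i)\<^sup>2" if "i < n" for i
    proof -
      have "((S *\<^sub>v x) $ i - 1 * x $ i)\<^sup>2 = (s * s) * ((h i)\<^sup>2 * (u $ i)\<^sup>2)"
        unfolding Sx[OF that] by (simp add: power2_eq_square)
      then show ?thesis by (simp add: s)
    qed
    then have "(\<Sum>i<n. ((S *\<^sub>v x) $ i - 1 * x $ i)\<^sup>2) = (\<Sum>i<n. (h i)\<^sup>2 * (u $ i)\<^sup>2)" by simp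
    \<comment> \<open>One factor \<open>1 / a\<close> comes from scaling \<open>u\<close> here, the
      other from scaling \<open>x\<close> in \<open>yx\<close>; together they produce the square of
      \<open>\<eta> / a\<close>.\<close>
    also have "\<dots> \<le> 1 / a * (\<Sum>i<n. (u $ i)\<^sup>2)" by (rule weight)
    also have "\<dots> \<le> 1 / a * (\<eta>\<^sup>2 * (1 / a * (\<Sum>i<n. (x $ i)\<^sup>2)))"
      using a by (intro mult_left_mono uu) simp
    finally show "(\<Sum>i<n. ((S *\<^sub>v x) $ i - 1 * x $ i)\<^sup>2) \<le> (\<eta> / a)\<^sup>2 * (\<Sum>i<n. (x $ i)\<^sup>2)"
      by (simp add: power2_eq_square)
  qed
  then show "size {#\<mu> \<in># eigenvalue_mset (inv_mat P * T). cmod (\<mu> - 1) > \<eta> / a#} \<le> card F"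
    by (simp add: spec)
qed

subsection \<open>The symbol\<close>

definition trig_poly :: "(int \<Rightarrow> real) \<Rightarrow> nat \<Rightarrow> real \<Rightarrow> real" where
  "trig_poly t K \<theta> = (\<Sum>m=-int K..int K. t m * cos (of_int m * \<theta>))"

text \<open>Quantifying over finite sets lets one predicate serve both the infinite tail of the
  symbol and the finite row sums of a Toeplitz matrix.\<close>

definition tail_le :: "(int \<Rightarrow> real) \<Rightarrow> nat \<Rightarrow> real \<Rightarrow> bool" where
  "tail_le t K \<delta> \<longleftrightarrow>
    (\<forall>F. finite F \<longrightarrow> F \<inter> {-int K..int K} = {} \<longrightarrow> (\<Sum>m\<in>F. \<bar>t m\<bar>) \<le> \<delta>)"

lemma ex_tail_le:
  fixes t :: "int \<Rightarrow> real"
  assumes "(\<lambda>m. \<bar>t m\<bar>) summable_on UNIV" and "\<delta> > 0"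
  obtains K where "tail_le t K \<delta>"
proof -
  obtain A where A: "finite A" "dist (\<Sum>m\<in>A. \<bar>t m\<bar>) (\<Sum>\<^sub>\<infinity>m. \<bar>t m\<bar>) \<le> \<delta>"
    using infsum_finite_approximation[OF assms] by blast
  \<comment> \<open>A crude bound on each \<open>\<bar>m\<bar>\<close> with \<open>m\<close> in
    \<open>A\<close> that also makes sense for empty \<open>A\<close>.\<close>
  define K where "K = nat (\<Sum>m\<in>A. \<bar>m\<bar>)"
  have "A \<subseteq> {-int K..int K}"
  proof
    fix m assume "m \<in> A"
    then have "\<bar>m\<bar> \<le> (\<Sum>m\<in>A. \<bar>m\<bar>)" using A(1) by (intro member_le_sum) auto
    then show "m \<in> {-int K..int K}" by (auto simp: K_def)
  qed
  have "(\<Sum>m\<in>F. \<bar>t m\<bar>) \<le> \<delta>" if F: "finite F" "F \<inter> {-int K..int K} = {}" for F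
  proof -
    have "(\<Sum>m\<in>A. \<bar>t m\<bar>) + (\<Sum>m\<in>F. \<bar>t m\<bar>) = (\<Sum>m\<in>A \<union> F. \<bar>t m\<bar>)"
      using A F \<open>A \<subseteq> _\<close> by (intro sum.union_disjoint[symmetric]) auto
    also have "\<dots> \<le> (\<Sum>\<^sub>\<infinity>m. \<bar>t m\<bar>)"
      using A F by (intro finite_sum_le_infsum assms) auto
    finally show ?thesis using A(2) by (simp add: dist_real_def)
  qed
  then show thesis using that unfolding tail_le_def by blast
qed

text \<open>The partial sum over \<open>-K..K\<close> is the real trigonometric polynomial because
  the sine terms cancel in pairs by evenness; the other terms have modulus
  \<open>\<bar>t m\<bar>\<close> and are controlled by the tail.\<close>

lemma norm_symbol_minus_trig_poly_le:
  fixes t :: "int \<Rightarrow> real"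
  assumes even_t: "\<And>m. t (- m) = t m" and sm: "(\<lambda>m. \<bar>t m\<bar>) summable_on UNIV"
    and tail: "tail_le t K \<delta>"
  shows "cmod (symbol t (cis \<theta>) - complex_of_real (trig_poly t K \<theta>)) \<le> \<delta>"
proof -
  let ?f = "\<lambda>m. complex_of_real (t m) * cis \<theta> powi m" and ?I = "{-int K..int K}"
  have nf: "cmod (?f m) = \<bar>t m\<bar>" for m by (simp add: norm_mult norm_power_int)
  have abs: "?f abs_summable_on A" for A
    unfolding nf using sm by (rule summable_on_subset_banach) simp
  have part: "sum ?f ?I = complex_of_real (trig_poly t K \<theta>)"
  proof (rule complex_eqI)
    show "Re (sum ?f ?I) = Re (complex_of_real (trig_poly t K \<theta>))"
      by (simp add: trig_poly_def cis_power_int)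
    have "(\<Sum>m\<in>?I. t m * sin (of_int m * \<theta>)) = (\<Sum>m\<in>?I. - (t m * sin (of_int m * \<theta>)))"
      by (rule sum.reindex_bij_witness[where i = uminus and j = uminus]) (auto simp: even_t)
    then have "(\<Sum>m\<in>?I. t m * sin (of_int m * \<theta>)) = 0" by (simp add: sum_negf)
    then show "Im (sum ?f ?I) = Im (complex_of_real (trig_poly t K \<theta>))"
      by (simp add: cis_power_int)
  qed
  have "symbol t (cis \<theta>) = infsum ?f (?I \<union> - ?I)" by (simp add: symbol_def)
  also have "\<dots> = sum ?f ?I + infsum ?f (- ?I)"
    by (subst infsum_Un_disjoint) (auto intro: abs_summable_summable abs)
  finally have "cmod (symbol t (cis \<theta>) - complex_of_real (trig_poly t K \<theta>)) = cmod (infsum ?f (- ?I))"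
    by (simp add: part)
  also have "\<dots> \<le> (\<Sum>\<^sub>\<infinity>m\<in>- ?I. cmod (?f m))" by (rule norm_infsum_bound[OF abs])
  also have "\<dots> \<le> \<delta>"
  proof (rule infsum_le_finite_sums[OF abs])
    fix F assume "finite F" "F \<subseteq> - ?I"
    then show "(\<Sum>m\<in>F. cmod (?f m)) \<le> \<delta>" using tail unfolding nf tail_le_def by auto
  qed
  finally show ?thesis .
qed

section \<open>The symbol as a real function of the angle\<close>

locale even_summable_symbol =
  fixes t :: "int \<Rightarrow> real"
  assumes even_t: "\<And>m. t (- m) = t m" and summable_t: "(\<lambda>m. \<bar>t m\<bar>) summable_on UNIV"
begin

definition g :: "real \<Rightarrow> real" where "g \<theta> = Re (symbol t (cis \<theta>))"

text \<open>The symbol lies within every \<open>\<delta> > 0\<close> of a real number, the value of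
  a trigonometric polynomial, so its imaginary part vanishes and the real part taken in
  \<open>g\<close> loses nothing.\<close>

lemma symbol_cis: "symbol t (cis \<theta>) = complex_of_real (g \<theta>)"
proof -
  have "\<bar>Im (symbol t (cis \<theta>))\<bar> \<le> \<delta>" if "\<delta> > 0" for \<delta>
  proof -
    obtain K where K: "tail_le t K \<delta>"
      using ex_tail_le[OF summable_t \<open>\<delta> > 0\<close>] by blast
    have "\<bar>Im (symbol t (cis \<theta>) - complex_of_real (trig_poly t K \<theta>))\<bar> \<le> \<delta>"
      using norm_symbol_minus_trig_poly_le[OF even_t summable_t K] abs_Im_le_cmod
      by (rule order_trans[rotated])
    then show ?thesis by simp
  qed
  then have "Im (symbol t (cis \<theta>)) = 0" by (metis abs_le_zero_iff dense_ge)
  then show ?thesis by (simp add: g_def complex_eq_iff)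
qed

lemma g_minus_trig_poly_le:
  assumes "tail_le t K \<delta>"
  shows "\<bar>g \<theta> - trig_poly t K \<theta>\<bar> \<le> \<delta>"
  using norm_symbol_minus_trig_poly_le[OF even_t summable_t assms]
  by (metis norm_of_real of_real_diff symbol_cis real_norm_def)

text \<open>\<open>g\<close> is a uniform limit of trigonometric polynomials; the argument splits
  \<open>e\<close> into three thirds.\<close>

lemma continuous_g: "continuous_on A g"
proof -
  have "isCont g \<theta>" for \<theta>
    unfolding isCont_def
  proof (rule metric_LIM_I)
    fix e :: real assume "e > 0"
    then have e: "e / 3 > 0" by simp
    obtain K where "tail_le t K (e / 3)" using ex_tail_le[OF summable_t e] by blast
    note K = g_minus_trig_poly_le[OF this]
    have "isCont (trig_poly t K) \<theta>" unfolding trig_poly_def by (intro continuous_intros)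
    then obtain r where r: "r > 0"
      "\<And>x. x \<noteq> \<theta> \<and> dist x \<theta> < r \<Longrightarrow> dist (trig_poly t K x) (trig_poly t K \<theta>) < e / 3"
      using metric_LIM_D[OF _ e] unfolding isCont_def by blast
    have "dist (g x) (g \<theta>) < e" if "x \<noteq> \<theta> \<and> dist x \<theta> < r" for x
      using r(2)[OF that] K[of x] K[of \<theta>] unfolding dist_real_def by linarith
    then show "\<exists>r>0. \<forall>x. x \<noteq> \<theta> \<and> dist x \<theta> < r \<longrightarrow> dist (g x) (g \<theta>) < e"
      using r(1) by blast
  qed
  then show ?thesis by (simp add: continuous_at_imp_continuous_on)
qed

lemma unit_circle_eq_cis:
  assumes "cmod z = 1"
  obtains \<theta> where "\<theta> \<in> {-pi..pi}" "z = cis \<theta>"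
proof -
  have "z = cis (Arg z)" using assms cis_Arg[of z] by (cases "z = 0") (auto simp: sgn_div_norm)
  then show thesis using that[of "Arg z"] Arg_bounded[of z] by simp
qed

lemma symbol_values: "(\<exists>z. cmod z = 1 \<and> symbol t z = complex_of_real y) \<longleftrightarrow> y \<in> g ` {-pi..pi}"
proof
  assume "\<exists>z. cmod z = 1 \<and> symbol t z = complex_of_real y"
  then show "y \<in> g ` {-pi..pi}" by (metis image_eqI of_real_eq_iff symbol_cis unit_circle_eq_cis)
next
  assume "y \<in> g ` {-pi..pi}"
  then show "\<exists>z. cmod z = 1 \<and> symbol t z = complex_of_real y" using norm_cis symbol_cis by blast
qed

lemma g_in_range: "g \<theta> \<in> g ` {-pi..pi}"
  using symbol_values[of "g \<theta>"] norm_cis symbol_cis by blast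

text \<open>Continuity on a compact interval makes the extreme values attained, so
  \<open>LEAST\<close> and \<open>GREATEST\<close> in \<open>symbol_min\<close> and
  \<open>symbol_max\<close> denote actual values of \<open>g\<close>.\<close>

lemma g_bounds: "symbol_min t \<le> g \<theta>" "g \<theta> \<le> symbol_max t"
proof -
  let ?I = "{-pi..pi}"
  have ne: "?I \<noteq> {}" by simp
  obtain \<alpha> where \<alpha>: "\<alpha> \<in> ?I" "\<And>\<theta>. \<theta> \<in> ?I \<Longrightarrow> g \<alpha> \<le> g \<theta>"
    using continuous_attains_inf[OF compact_Icc ne continuous_g] by blast
  obtain \<beta> where \<beta>: "\<beta> \<in> ?I" "\<And>\<theta>. \<theta> \<in> ?I \<Longrightarrow> g \<theta> \<le> g \<beta>"
    using continuous_attains_sup[OF compact_Icc ne continuous_g] by blast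
  have "symbol_min t = g \<alpha>"
    unfolding symbol_min_def symbol_values by (rule Least_equality) (use \<alpha> in auto)
  then show "symbol_min t \<le> g \<theta>" using \<alpha> g_in_range[of \<theta>] by auto
  have "symbol_max t = g \<beta>"
    unfolding symbol_max_def symbol_values by (rule Greatest_equality) (use \<beta> in auto)
  then show "g \<theta> \<le> symbol_max t" using \<beta> g_in_range[of \<theta>] by auto
qed

text \<open>By the intermediate value theorem a continuous function without zeros keeps its sign
  \<open>s\<close>; compactness then gives a positive lower bound for \<open>s * g\<close>.\<close>

lemma nonvanishing_symbol_definite:
  assumes nz: "\<And>z. cmod z = 1 \<Longrightarrow> symbol t z \<noteq> 0"
  obtains s a where "s * s = 1" "a > 0" "\<And>\<theta>. s * g \<theta> \<ge> a"
proof -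
  let ?I = "{-pi..pi}"
  have g0: "g \<theta> \<noteq> 0" for \<theta> using nz[of "cis \<theta>"] by (simp add: symbol_cis)
  define s where "s = sgn (g 0)"
  have s: "s * s = 1" using g0[of 0] by (simp add: s_def sgn_if)
  have pos: "s * g \<theta> > 0" for \<theta>
  proof (rule ccontr)
    assume "\<not> s * g \<theta> > 0"
    then have neg: "s * g \<theta> \<le> 0" by simp
    have "s * g 0 \<ge> 0" by (simp add: s_def sgn_if)
    moreover have "connected (range (\<lambda>\<theta>. s * g \<theta>))"
      by (intro connected_continuous_image continuous_intros continuous_g connected_UNIV)
    ultimately have "0 \<in> range (\<lambda>\<theta>. s * g \<theta>)"
      using neg connectedD_interval[of "range (\<lambda>\<theta>. s * g \<theta>)" "s * g \<theta>" "s * g 0" 0] by auto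
    then show False using g0 s by auto
  qed
  have ne: "?I \<noteq> {}" by simp
  have "continuous_on ?I (\<lambda>\<theta>. s * g \<theta>)" by (intro continuous_intros continuous_g)
  then obtain \<alpha> where \<alpha>: "\<And>\<theta>. \<theta> \<in> ?I \<Longrightarrow> s * g \<alpha> \<le> s * g \<theta>"
    using continuous_attains_inf[OF compact_Icc ne] by blast
  have "s * g \<alpha> \<le> s * g \<theta>" for \<theta>
    using g_in_range[of \<theta>] \<alpha> by force
  then show thesis using that[OF s pos] by blast
qed

end

text \<open>Along a row the indices \<open>k - l\<close> are distinct, so this is a finite sum of
  distinct tail coefficients.\<close>

lemma toeplitz_row_sum_le:
  fixes t :: "int \<Rightarrow> real"
  assumes tail: "tail_le t K \<delta>"
  shows "(\<Sum>l<n. \<bar>if \<bar>int k - int l\<bar> \<le> int K then 0 else t (int k - int l)\<bar>) \<le> \<delta>"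
proof -
  let ?J = "{l \<in> {..<n}. \<not> \<bar>int k - int l\<bar> \<le> int K}"
  have "(\<Sum>l<n. \<bar>if \<bar>int k - int l\<bar> \<le> int K then 0 else t (int k - int l)\<bar>)
      = (\<Sum>l\<in>?J. \<bar>t (int k - int l)\<bar>)"
    by (rule sum.mono_neutral_cong_right) auto
  also have "\<dots> = (\<Sum>m\<in>(\<lambda>l. int k - int l) ` ?J. \<bar>t m\<bar>)"
    by (subst sum.reindex) (auto simp: inj_on_def)
  also have "\<dots> \<le> \<delta>" by (rule tail[unfolded tail_le_def, rule_format]) auto
  finally show ?thesis .
qed

subsection \<open>Optimal approximation and Toeplitz matrices\<close>

text \<open>The difference \<open>D\<close> between \<open>G\<close> and the candidate lies in the
  gamma space, while the residual \<open>E\<close> has vanishing Rayleigh quotients on all columns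
  and is thus orthogonal to that space. By Pythagoras, minimality of \<open>G\<close> forces
  \<open>D\<close> to vanish.\<close>

lemma gamma_space_minimizer:
  fixes T G :: "real mat"
  assumes T: "T \<in> carrier_mat n n"
    and G: "is_arg_min (\<lambda>A. frobenius_norm (A - T)) (\<lambda>A. A \<in> gamma_space n) G"
  shows "G = gamma_mat n (vec n (\<lambda>j. \<Sum>k<n. \<Sum>l<n.
      gamma_Q n $$ (k, j) * T $$ (k, l) * gamma_Q n $$ (l, j)))"
proof -
  define \<tau> where "\<tau> = vec n (\<lambda>j. \<Sum>k<n. \<Sum>l<n.
      gamma_Q n $$ (k, j) * T $$ (k, l) * gamma_Q n $$ (l, j))"
  let ?q = "\<lambda>k j. gamma_Q n $$ (k, j)"
  let ?H = "gamma_mat n \<tau>"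
  obtain v where v: "G = gamma_mat n v" "v \<in> carrier_vec n"
    using G by (auto simp: is_arg_min_def gamma_space_def)
  have "?H \<in> gamma_space n" by (auto simp: gamma_space_def \<tau>_def)
  then have le: "frobenius_norm (G - T) \<le> frobenius_norm (?H - T)"
    using G unfolding is_arg_min_def by (metis linorder_not_less)
  have frob: "frobenius_norm (A - T) = sqrt (\<Sum>k<n. \<Sum>l<n. (A $$ (k, l) - T $$ (k, l))\<^sup>2)"
    if "A \<in> carrier_mat n n" for A
    unfolding frobenius_norm_def using that T by (intro arg_cong[where f = sqrt] sum.cong) auto
  define D where "D k l = G $$ (k, l) - ?H $$ (k, l)" for k l
  define E where "E k l = ?H $$ (k, l) - T $$ (k, l)" for k l
  have D: "D k l = (\<Sum>j<n. ?q k j * ?q l j * (v $ j - \<tau> $ j))" if "k < n" "l < n" for k l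
    using that by (simp add: D_def v gamma_mat_index sum_subtractf[symmetric] right_diff_distrib)
  have E: "(\<Sum>k<n. \<Sum>l<n. ?q k j * E k l * ?q l j) = 0" if "j < n" for j
  proof -
    have "(\<Sum>k<n. \<Sum>l<n. ?q k j * E k l * ?q l j)
        = (\<Sum>k<n. \<Sum>l<n. ?q k j * ?H $$ (k, l) * ?q l j) - (\<Sum>k<n. \<Sum>l<n. ?q k j * T $$ (k, l) * ?q l j)"
      by (simp add: E_def sum_subtractf[symmetric] algebra_simps)
    also have "\<dots> = 0" unfolding gamma_mat_form[OF that] using that by (simp add: \<tau>_def)
    finally show ?thesis .
  qed
  \<comment> \<open>Expanding \<open>D\<close> in the rank-one matrices of the columns reduces the
    inner product to the Rayleigh quotients of \<open>E\<close>.\<close>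
  have "(\<Sum>k<n. \<Sum>l<n. D k l * E k l)
      = (\<Sum>k<n. \<Sum>l<n. \<Sum>j<n. (v $ j - \<tau> $ j) * (?q k j * E k l * ?q l j))"
    by (intro sum.cong refl) (simp add: D sum_distrib_left sum_distrib_right mult_ac)
  also have "\<dots> = (\<Sum>k<n. \<Sum>j<n. \<Sum>l<n. (v $ j - \<tau> $ j) * (?q k j * E k l * ?q l j))"
    by (intro sum.cong refl sum.swap)
  also have "\<dots> = (\<Sum>j<n. \<Sum>k<n. \<Sum>l<n. (v $ j - \<tau> $ j) * (?q k j * E k l * ?q l j))"
    by (rule sum.swap)
  also have "\<dots> = (\<Sum>j<n. (v $ j - \<tau> $ j) * (\<Sum>k<n. \<Sum>l<n. ?q k j * E k l * ?q l j))"
    by (simp only: sum_distrib_left)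
  also have "\<dots> = 0" by (simp add: E)
  finally have orth: "(\<Sum>k<n. \<Sum>l<n. D k l * E k l) = 0" .
  have "(\<Sum>k<n. \<Sum>l<n. (G $$ (k, l) - T $$ (k, l))\<^sup>2)
      = (\<Sum>k<n. \<Sum>l<n. (D k l)\<^sup>2 + (E k l)\<^sup>2 + 2 * (D k l * E k l))"
    by (intro sum.cong refl) (simp add: D_def E_def power2_eq_square algebra_simps)
  also have "\<dots> = (\<Sum>k<n. \<Sum>l<n. (D k l)\<^sup>2) + (\<Sum>k<n. \<Sum>l<n. (E k l)\<^sup>2)"
    by (simp add: sum.distrib sum_distrib_left[symmetric] orth)
  finally have "(\<Sum>k<n. \<Sum>l<n. (D k l)\<^sup>2) \<le> 0"
    using le v(1) by (simp add: frob E_def)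
  then have "(\<Sum>k<n. \<Sum>l<n. (D k l)\<^sup>2) = 0" by (intro antisym sum_nonneg) auto
  then have "\<forall>k<n. \<forall>l<n. D k l = 0" by (simp add: sum_nonneg_eq_0_iff sum_nonneg)
  then have "G = gamma_mat n \<tau>" by (intro eq_matI) (auto simp: D_def v)
  then show ?thesis by (simp add: \<tau>_def)
qed

lemma gamma_mat_similar_diag: "similar_mat (gamma_mat n v) (mat_diag n (\<lambda>j. v $ j))"
proof -
  have "similar_mat_wit (gamma_mat n v) (mat_diag n (\<lambda>j. v $ j)) (gamma_Q n) (transpose_mat (gamma_Q n))"
    by (simp add: similar_mat_wit_def Let_def gamma_Q_orthogonal) (simp add: gamma_mat_def)
  then show ?thesis by (auto simp: similar_mat_def)
qed

lemma eigenvalue_gamma_mat: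
  assumes "eigenvalue (map_mat complex_of_real (gamma_mat n v)) \<mu>"
  obtains j where "j < n" "\<mu> = complex_of_real (v $ j)"
proof -
  let ?A = "map_mat complex_of_real (gamma_mat n v)"
  have A: "?A \<in> carrier_mat n n" by simp
  have "char_poly ?A \<noteq> 0" using degree_monic_char_poly[OF A] by auto
  then have "\<mu> \<in># eigenvalue_mset (gamma_mat n v)"
    using assms unfolding eigenvalue_root_char_poly[OF A] eigenvalue_mset_def by simp
  then show thesis
    using that by (auto simp: eigenvalue_mset_similar[OF gamma_mat_similar_diag] eigenvalue_mset_mat_diag)
qed

text \<open>The orthogonal factors preserve norms and the diagonal one scales each coordinate by at
  most \<open>\<beta>\<close>. This controls the distance of \<open>G n\<close> from the truncated
  circulant.\<close>

lemma gamma_mat_norm_le: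
  fixes y :: "nat \<Rightarrow> real"
  assumes \<beta>: "\<And>j. j < n \<Longrightarrow> \<bar>v $ j\<bar> \<le> \<beta>"
  shows "(\<Sum>k<n. (\<Sum>l<n. gamma_mat n v $$ (k, l) * y l)\<^sup>2) \<le> \<beta>\<^sup>2 * (\<Sum>l<n. (y l)\<^sup>2)"
proof -
  let ?Q = "gamma_Q n" and ?y = "vec n y"
  let ?u = "transpose_mat ?Q *\<^sub>v ?y"
  have Qt: "transpose_mat ?Q \<in> carrier_mat n n" by simp
  have y: "?y \<in> carrier_vec n" by simp
  have u: "?u \<in> carrier_vec n" by (rule mult_mat_vec_carrier[OF Qt y])
  have Du: "mat_diag n (\<lambda>j. v $ j) *\<^sub>v ?u \<in> carrier_vec n" by (rule mult_mat_vec_carrier[OF _ u]) simp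
  have "gamma_mat n v *\<^sub>v ?y = (?Q * mat_diag n (\<lambda>j. v $ j)) *\<^sub>v ?u"
    unfolding gamma_mat_def by (rule assoc_mult_mat_vec[of _ n n _ n, OF _ Qt y]) (simp add: mult_carrier_mat[of _ n n _ n])
  also have "\<dots> = ?Q *\<^sub>v (mat_diag n (\<lambda>j. v $ j) *\<^sub>v ?u)"
    by (rule assoc_mult_mat_vec[of _ n n _ n, OF _ _ u]) auto
  finally have "(\<Sum>k<n. ((gamma_mat n v *\<^sub>v ?y) $ k)\<^sup>2) = (\<Sum>k<n. ((mat_diag n (\<lambda>j. v $ j) *\<^sub>v ?u) $ k)\<^sup>2)"
    using orthogonal_mat_norm[OF gamma_Q_carrier gamma_Q_orthogonal(2) Du] by (simp only:)
  also have "\<dots> = (\<Sum>k<n. (v $ k)\<^sup>2 * (?u $ k)\<^sup>2)"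
    by (intro sum.cong refl) (simp only: lessThan_iff index_mat_diag_mult_vec[OF u] power_mult_distrib)
  also have "\<dots> \<le> (\<Sum>k<n. \<beta>\<^sup>2 * (?u $ k)\<^sup>2)"
  proof (intro sum_mono mult_right_mono)
    fix k assume "k \<in> {..<n}"
    then show "(v $ k)\<^sup>2 \<le> \<beta>\<^sup>2" using \<beta>[of k] by (intro power2_le_iff_abs_le[THEN iffD2]) auto
  qed simp
  also have "\<dots> = \<beta>\<^sup>2 * (\<Sum>k<n. (?y $ k)\<^sup>2)"
    using orthogonal_mat_norm[OF Qt _ y] by (simp only: sum_distrib_left[symmetric] transpose_transpose gamma_Q_orthogonal)
  finally have "(\<Sum>k<n. ((gamma_mat n v *\<^sub>v ?y) $ k)\<^sup>2) \<le> \<beta>\<^sup>2 * (\<Sum>k<n. (?y $ k)\<^sup>2)" .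
  moreover have "(gamma_mat n v *\<^sub>v ?y) $ k = (\<Sum>l<n. gamma_mat n v $$ (k, l) * y l)" if "k < n" for k
    using index_mult_mat_vec_sum[OF gamma_mat_carrier y that] by simp
  ultimately show ?thesis by simp
qed

section \<open>Splitting the Toeplitz matrix into circulant, corner and off-band parts\<close>

context even_summable_symbol
begin

definition rayleigh :: "nat \<Rightarrow> nat \<Rightarrow> real" where
  "rayleigh n j = (\<Sum>k<n. \<Sum>l<n. gamma_Q n $$ (k, j) * toeplitz t n $$ (k, l) * gamma_Q n $$ (l, j))"

definition trunc_eig :: "nat \<Rightarrow> nat \<Rightarrow> real vec" where
  "trunc_eig K n = vec n (\<lambda>j. trig_poly t K (2 * pi * real j / real n))"

text \<open>Banded Toeplitz matrix minus its circulant counterpart: what survives, up to sign, are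
  the coefficients wrapped around modulo \<open>n\<close>.\<close>

definition corner :: "nat \<Rightarrow> nat \<Rightarrow> nat \<Rightarrow> nat \<Rightarrow> real" where
  "corner K n k l = (if \<bar>int k - int l\<bar> \<le> int K then t (int k - int l) else 0)
    - gamma_mat n (trunc_eig K n) $$ (k, l)"

definition off_band :: "nat \<Rightarrow> nat \<Rightarrow> nat \<Rightarrow> real" where
  "off_band K k l = (if \<bar>int k - int l\<bar> \<le> int K then 0 else t (int k - int l))"

definition border :: "nat \<Rightarrow> nat \<Rightarrow> nat set" where
  "border K n = {..<K} \<union> {n - K..<n}"

lemma t_abs: "t \<bar>m\<bar> = t m"
  by (cases "m \<ge> 0") (simp_all add: even_t)

lemma toeplitz_split:
  assumes "k < n" "l < n"
  shows "toeplitz t n $$ (k, l) = gamma_mat n (trunc_eig K n) $$ (k, l) + corner K n k l + off_band K k l"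
  using assms by (simp add: toeplitz_def corner_def off_band_def t_abs)

lemma card_border: "finite (border K n)" "card (border K n) \<le> 2 * K"
proof -
  have "card (border K n) \<le> card {..<K} + card {n - K..<n}"
    unfolding border_def by (rule card_Un_le)
  then show "card (border K n) \<le> 2 * K" by simp
qed (simp add: border_def)

lemma trunc_mat_index:
  assumes "k < n" "l < n"
  shows "gamma_mat n (trunc_eig K n) $$ (k, l)
    = (\<Sum>m=-int K..int K. if int n dvd int k - int l - m then t m else 0)"
  unfolding trunc_eig_def trig_poly_def by (rule gamma_mat_trig_poly_index[of t, OF even_t assms])

text \<open>An index outside the border has distance at most \<open>n - 1 - K\<close> from every
  other index, so no coefficient of the band wraps around to that position.\<close>

lemma corner_eq_0:
  assumes "k < n" "l < n" "k \<notin> border K n \<or> l \<notin> border K n"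
  shows "corner K n k l = 0"
proof -
  have "\<bar>int k - int l\<bar> + int K < int n" using assms by (auto simp: border_def)
  then show ?thesis
    unfolding corner_def trunc_mat_index[OF assms(1,2)] by (subst wrapped_coefficients_inside_band) auto
qed

text \<open>The banded entry and the wrapped entry are each a sum of some of the coefficients in the
  band, whence the factor 2.\<close>

lemma corner_bound:
  assumes "k < n" "l < n"
  shows "\<bar>corner K n k l\<bar> \<le> 2 * (\<Sum>m=-int K..int K. \<bar>t m\<bar>)"
proof -
  let ?M = "\<Sum>m=-int K..int K. \<bar>t m\<bar>"
  have "\<bar>if \<bar>int k - int l\<bar> \<le> int K then t (int k - int l) else 0\<bar> \<le> ?M"
  proof (cases "\<bar>int k - int l\<bar> \<le> int K")
    case True
    then have "int k - int l \<in> {-int K..int K}" by auto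
    then have "\<bar>t (int k - int l)\<bar> \<le> ?M" by (rule member_le_sum) auto
    then show ?thesis using True by simp
  qed (simp add: sum_nonneg)
  moreover have "\<bar>gamma_mat n (trunc_eig K n) $$ (k, l)\<bar> \<le> ?M"
    unfolding trunc_mat_index[OF assms] by (rule order_trans[OF sum_abs]) (intro sum_mono, auto)
  ultimately show ?thesis unfolding corner_def by linarith
qed

lemma off_band_norm_le:
  assumes tail: "tail_le t K \<delta>"
  shows "(\<Sum>k<n. (\<Sum>l<n. off_band K k l * y l)\<^sup>2) \<le> \<delta>\<^sup>2 * (\<Sum>l<n. (y l)\<^sup>2)"
proof (rule schur_test)
  show row: "(\<Sum>l<n. \<bar>off_band K k l\<bar>) \<le> \<delta>" for k
    unfolding off_band_def by (rule toeplitz_row_sum_le[OF tail])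
  have sym: "off_band K k l = off_band K l k" for k l
    using even_t[of "int k - int l"] by (simp add: off_band_def abs_minus_commute)
  show "(\<Sum>k<n. \<bar>off_band K k l\<bar>) \<le> \<delta>" for l
    unfolding sym[of _ l] by (rule row)
  show "\<delta> \<ge> 0" using tail[unfolded tail_le_def, rule_format, of "{}"] by simp
qed

text \<open>The circulant part contributes exactly \<open>trunc_eig K n $ j\<close> and the off-band
  part at most \<open>\<delta>\<close>. The corner has at most \<open>(2 * K)\<^sup>2\<close>
  nonzero entries, each weighted by at most \<open>2 / n\<close> and bounded by twice the sum of the
  moduli, which gives the constant 16.\<close>

lemma rayleigh_minus_trunc_eig_le:
  assumes tail: "tail_le t K \<delta>" and j: "j < n"
  shows "\<bar>rayleigh n j - trunc_eig K n $ j\<bar>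
    \<le> 16 * (real K)\<^sup>2 * (\<Sum>m=-int K..int K. \<bar>t m\<bar>) / real n + \<delta>"
proof -
  let ?q = "\<lambda>k. gamma_Q n $$ (k, j)" and ?M = "\<Sum>m=-int K..int K. \<bar>t m\<bar>"
  \<comment> \<open>For \<open>n < K\<close> the border contains indices that are not below
    \<open>n\<close>, hence the intersection.\<close>
  let ?B = "border K n \<inter> {..<n}"
  have M0: "?M \<ge> 0" by (simp add: sum_nonneg)
  have \<delta>: "\<delta> \<ge> 0" using tail[unfolded tail_le_def, rule_format, of "{}"] by simp
  have "rayleigh n j = (\<Sum>k<n. \<Sum>l<n. ?q k * gamma_mat n (trunc_eig K n) $$ (k, l) * ?q l
      + ?q k * corner K n k l * ?q l + ?q k * off_band K k l * ?q l)"
    unfolding rayleigh_def by (intro sum.cong refl) (simp add: toeplitz_split[of _ n _ K] algebra_simps)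
  also have "\<dots> = (\<Sum>k<n. \<Sum>l<n. ?q k * gamma_mat n (trunc_eig K n) $$ (k, l) * ?q l)
      + (\<Sum>k<n. \<Sum>l<n. ?q k * corner K n k l * ?q l) + (\<Sum>k<n. \<Sum>l<n. ?q k * off_band K k l * ?q l)"
    by (simp only: sum.distrib)
  finally have eq: "rayleigh n j - trunc_eig K n $ j
      = (\<Sum>k<n. \<Sum>l<n. ?q k * corner K n k l * ?q l) + (\<Sum>k<n. \<Sum>l<n. ?q k * off_band K k l * ?q l)"
    by (simp only: gamma_mat_form[OF j])
  have "\<bar>\<Sum>k<n. \<Sum>l<n. ?q k * off_band K k l * ?q l\<bar> \<le> \<delta> * (\<Sum>l<n. (?q l)\<^sup>2)"
    by (rule quadratic_form_le[OF off_band_norm_le[OF tail] \<delta>])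
  also have "(\<Sum>l<n. (?q l)\<^sup>2) = 1"
    using gamma_Q_columns_orthonormal[OF j j] by (simp add: power2_eq_square)
  finally have off: "\<bar>\<Sum>k<n. \<Sum>l<n. ?q k * off_band K k l * ?q l\<bar> \<le> \<delta>" by simp
  have qq: "\<bar>?q k\<bar> * \<bar>?q l\<bar> \<le> 2 / real n" if "k < n" "l < n" for k l
  proof -
    have "0 \<le> (\<bar>?q k\<bar> - \<bar>?q l\<bar>)\<^sup>2" by simp
    then have "2 * (\<bar>?q k\<bar> * \<bar>?q l\<bar>) \<le> (?q k)\<^sup>2 + (?q l)\<^sup>2"
      by (simp add: power2_diff)
    then show ?thesis
      using gamma_Q_entry_sq_le[OF that(1) j] gamma_Q_entry_sq_le[OF that(2) j] by linarith
  qed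
  define c where "c = 2 / real n * (2 * ?M)"
  have entry_le: "\<bar>?q k * corner K n k l * ?q l\<bar> \<le> 2 / real n * (2 * ?M)" if "k < n" "l < n" for k l
  proof -
    have "\<bar>?q k * corner K n k l * ?q l\<bar> = (\<bar>?q k\<bar> * \<bar>?q l\<bar>) * \<bar>corner K n k l\<bar>"
      by (simp add: abs_mult)
    also have "\<dots> \<le> 2 / real n * (2 * ?M)"
      using qq[OF that] corner_bound[OF that] by (intro mult_mono) auto
    finally show ?thesis .
  qed
  have restrict: "(\<Sum>k<n. \<Sum>l<n. ?q k * corner K n k l * ?q l) = (\<Sum>k\<in>?B. \<Sum>l\<in>?B. ?q k * corner K n k l * ?q l)"
  proof -
    have supp: "k \<in> border K n \<and> l \<in> border K n" if "corner K n k l \<noteq> 0" "k < n" "l < n" for k l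
      using corner_eq_0[OF that(2,3)] that(1) by blast
    have "(\<Sum>k<n. \<Sum>l<n. ?q k * corner K n k l * ?q l) = (\<Sum>k\<in>?B. \<Sum>l<n. ?q k * corner K n k l * ?q l)"
      by (rule sum.mono_neutral_right) (auto dest: supp intro!: sum.neutral)
    also have "\<dots> = (\<Sum>k\<in>?B. \<Sum>l\<in>?B. ?q k * corner K n k l * ?q l)"
      by (intro sum.cong refl sum.mono_neutral_right) (auto dest: supp)
    finally show ?thesis .
  qed
  have "\<bar>\<Sum>k<n. \<Sum>l<n. ?q k * corner K n k l * ?q l\<bar> \<le> (\<Sum>k\<in>?B. \<Sum>l\<in>?B. \<bar>?q k * corner K n k l * ?q l\<bar>)"
    unfolding restrict by (rule order_trans[OF sum_abs]) (intro sum_mono sum_abs)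
  also have "\<dots> \<le> (\<Sum>k\<in>?B. \<Sum>l\<in>?B. c)"
  proof (intro sum_mono)
    fix k l assume "k \<in> ?B" "l \<in> ?B"
    then show "\<bar>?q k * corner K n k l * ?q l\<bar> \<le> c" unfolding c_def by (intro entry_le) simp_all
  qed
  also have "\<dots> = (real (card ?B))\<^sup>2 * c"
    by (simp only: sum_constant power2_eq_square mult.assoc)
  also have "\<dots> \<le> (2 * real K)\<^sup>2 * c"
  proof (rule mult_right_mono[OF power_mono])
    have "card ?B \<le> card (border K n)" by (rule card_mono[OF card_border(1)]) simp
    then have "card ?B \<le> 2 * K" using card_border(2)[of K n] by simp
    then show "real (card ?B) \<le> 2 * real K" by linarith
    show "c \<ge> 0" unfolding c_def using M0 by (intro mult_nonneg_nonneg) simp_all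
  qed simp
  also have "\<dots> = 16 * (real K)\<^sup>2 * ?M / real n" by (simp add: c_def power_mult_distrib)
  finally show ?thesis unfolding eq using off by linarith
qed

lemma eventually_rayleigh_close:
  assumes tail: "tail_le t K \<delta>" and \<delta>: "\<delta> > 0"
  obtains n0 where "n0 > 0" "\<And>n j. n \<ge> n0 \<Longrightarrow> j < n \<Longrightarrow> \<bar>rayleigh n j - trunc_eig K n $ j\<bar> \<le> 2 * \<delta>"
proof -
  let ?c = "16 * (real K)\<^sup>2 * (\<Sum>m=-int K..int K. \<bar>t m\<bar>)"
  obtain n0 where n0: "?c / \<delta> < real n0" using reals_Archimedean2 by blast
  have "\<bar>rayleigh n j - trunc_eig K n $ j\<bar> \<le> 2 * \<delta>" if "n \<ge> Suc n0" "j < n" for n j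
  proof -
    have "?c / \<delta> \<le> real n" using n0 that by linarith
    then have "?c / real n \<le> \<delta>" using \<delta> that by (simp add: field_simps)
    then show ?thesis using rayleigh_minus_trunc_eig_le[OF tail that(2)] by linarith
  qed
  then show thesis using that[of "Suc n0"] by blast
qed

end

text \<open>The inverse in the second claim makes sense only for invertible \<open>G n\<close>; that
  claim is therefore stated for symbols without zeros on the unit circle and asserts invertibility
  together with the clustering.\<close>

theorem theorem6p3:
  fixes t :: "int \<Rightarrow> real" and G C B :: "nat \<Rightarrow> real mat"
  assumes even_t: "\<And>j. t (- j) = t j"
    and summable_t: "(\<lambda>j. \<bar>t j\<bar>) summable_on UNIV"
    and G_eq: "\<And>n. n \<ge> 1 \<Longrightarrow> G n = C n + B n"
    and C_in: "\<And>n. n \<ge> 1 \<Longrightarrow> C n \<in> C_space n"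
    and B_in: "\<And>n. n \<ge> 1 \<Longrightarrow> B n \<in> B_space n"
    and G_min: "\<And>n. n \<ge> 1 \<Longrightarrow>
      is_arg_min (\<lambda>A. frobenius_norm (A - toeplitz t n)) (\<lambda>A. A \<in> gamma_space n) (G n)"
  shows
    "(\<forall>\<epsilon>>0. \<exists>n0>0. \<forall>n\<ge>n0. \<forall>\<mu>. eigenvalue (map_mat complex_of_real (G n)) \<mu> \<longrightarrow>
        \<mu> \<in> complex_of_real ` {symbol_min t - \<epsilon> .. symbol_max t + \<epsilon>})
     \<and> ((\<forall>z. cmod z = 1 \<longrightarrow> symbol t z \<noteq> 0) \<longrightarrow>
        (\<forall>\<epsilon>>0. \<exists>k n1. n1 > 0 \<and> (\<forall>n\<ge>n1. invertible_mat (G n) \<and>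
          size {#\<mu> \<in># eigenvalue_mset (inv_mat (G n) * toeplitz t n). cmod (\<mu> - 1) > \<epsilon>#} < k)))"
proof -
  interpret even_summable_symbol t using even_t summable_t by unfold_locales
  have T: "toeplitz t n \<in> carrier_mat n n" for n by (simp add: toeplitz_def)
  have G: "G n = gamma_mat n (vec n (rayleigh n))" if "n \<ge> 1" for n
    using gamma_space_minimizer[OF T G_min[OF that]] by (simp add: rayleigh_def[abs_def])
  \<comment> \<open>Two parts \<open>\<delta>\<close> come from the distance to the sampled
    truncation, one from truncating the symbol.\<close>
  have close: "\<bar>rayleigh n j - g (2 * pi * real j / real n)\<bar> \<le> 3 * \<delta>"
    if "tail_le t K \<delta>" "j < n" "\<bar>rayleigh n j - trunc_eig K n $ j\<bar> \<le> 2 * \<delta>" for K n j \<delta>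
    using g_minus_trig_poly_le[OF that(1), of "2 * pi * real j / real n"] that(2,3)
    by (simp add: trunc_eig_def)
  show ?thesis
  proof (intro conjI impI allI)
    fix \<epsilon> :: real assume "\<epsilon> > 0"
    then have \<delta>: "\<epsilon> / 3 > 0" by simp
    obtain K where K: "tail_le t K (\<epsilon> / 3)" using ex_tail_le[OF summable_t \<delta>] by blast
    obtain n0 where n0: "n0 > 0"
      "\<And>n j. n \<ge> n0 \<Longrightarrow> j < n \<Longrightarrow> \<bar>rayleigh n j - trunc_eig K n $ j\<bar> \<le> 2 * (\<epsilon> / 3)"
      using eventually_rayleigh_close[OF K \<delta>] by blast
    show "\<exists>n0>0. \<forall>n\<ge>n0. \<forall>\<mu>. eigenvalue (map_mat complex_of_real (G n)) \<mu> \<longrightarrow>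
        \<mu> \<in> complex_of_real ` {symbol_min t - \<epsilon> .. symbol_max t + \<epsilon>}"
    proof (intro exI[of _ n0] conjI n0(1) allI impI)
      fix n \<mu> assume n: "n \<ge> n0" and "eigenvalue (map_mat complex_of_real (G n)) \<mu>"
      then obtain j where j: "j < n" "\<mu> = complex_of_real (rayleigh n j)"
        using G[of n] n0(1) by (auto elim!: eigenvalue_gamma_mat)
      have "\<bar>rayleigh n j - g (2 * pi * real j / real n)\<bar> \<le> \<epsilon>"
        using close[OF K j(1) n0(2)[OF n j(1)]] by simp
      then have "rayleigh n j \<in> {symbol_min t - \<epsilon> .. symbol_max t + \<epsilon>}"
        using g_bounds[of "2 * pi * real j / real n"] by auto
      then show "\<mu> \<in> complex_of_real ` {symbol_min t - \<epsilon> .. symbol_max t + \<epsilon>}" using j(2) by blast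
    qed
  next
    fix \<epsilon> :: real
    assume nz: "\<forall>z. cmod z = 1 \<longrightarrow> symbol t z \<noteq> 0" and \<epsilon>: "\<epsilon> > 0"
    obtain s a where s: "s * s = 1" and a: "a > 0" and sg: "\<And>\<theta>. s * g \<theta> \<ge> a"
      using nonvanishing_symbol_definite nz by metis
    \<comment> \<open>The first bound keeps every \<open>s * rayleigh n j\<close> above
      \<open>a / 2\<close>; the second makes the quotient of the perturbation
      \<open>4 * \<delta>\<close> by \<open>a / 2\<close> at most \<open>\<epsilon>\<close>.\<close>
    define \<delta> where "\<delta> = min (a / 6) (\<epsilon> * a / 8)"
    have \<delta>: "\<delta> > 0" "3 * \<delta> \<le> a / 2" "4 * \<delta> / (a / 2) \<le> \<epsilon>"
      using a \<epsilon> by (auto simp: \<delta>_def field_simps min_def)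
    obtain K where K: "tail_le t K \<delta>" using ex_tail_le[OF summable_t \<delta>(1)] by blast
    obtain n0 where n0: "n0 > 0"
      "\<And>n j. n \<ge> n0 \<Longrightarrow> j < n \<Longrightarrow> \<bar>rayleigh n j - trunc_eig K n $ j\<bar> \<le> 2 * \<delta>"
      using eventually_rayleigh_close[OF K \<delta>(1)] by blast
    have "invertible_mat (G n) \<and>
        size {#\<mu> \<in># eigenvalue_mset (inv_mat (G n) * toeplitz t n). cmod (\<mu> - 1) > \<epsilon>#} < 2 * K + 1"
      if n: "n \<ge> n0" for n
    proof -
      define d where "d = vec n (\<lambda>j. rayleigh n j - trunc_eig K n $ j)"
      \<comment> \<open>\<open>G n\<close> is the truncated circulant plus
        \<open>gamma_mat n d\<close>, so this small matrix is what separates the Toeplitz matrix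
        from \<open>G n\<close> apart from the corner.\<close>
      define E where "E k l = off_band K k l - gamma_mat n d $$ (k, l)" for k l
      have Gn: "G n = gamma_Q n * mat_diag n (rayleigh n) * transpose_mat (gamma_Q n)"
        using G[of n] n n0(1) mat_diag_cong[of n "\<lambda>j. vec n (rayleigh n) $ j" "rayleigh n"]
        by (simp add: gamma_mat_def)
      have symT: "transpose_mat (toeplitz t n) = toeplitz t n"
        by (rule eq_matI) (auto simp: toeplitz_def abs_minus_commute)
      have pos: "s * rayleigh n j \<ge> a / 2" if j: "j < n" for j
      proof -
        let ?g = "g (2 * pi * real j / real n)"
        have "\<bar>s\<bar> = 1" using s by (metis abs_mult_self_eq abs_1 mult_cancel_left1
              abs_mult abs_square_eq_1 power2_eq_square)
        then have "\<bar>s * rayleigh n j - s * ?g\<bar> \<le> 3 * \<delta>"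
          using close[OF K j n0(2)[OF n j]] by (simp add: right_diff_distrib[symmetric] abs_mult)
        then show ?thesis using sg[of "2 * pi * real j / real n"] \<delta>(2) by linarith
      qed
      have split: "toeplitz t n $$ (k, l) = G n $$ (k, l) + corner K n k l + E k l"
        if "k < n" "l < n" for k l
      proof -
        have "G n $$ (k, l) = gamma_mat n (trunc_eig K n) $$ (k, l) + gamma_mat n d $$ (k, l)"
          using G[of n] n n0(1) that
          by (simp add: gamma_mat_index d_def sum.distrib[symmetric] algebra_simps)
        then show ?thesis by (simp add: toeplitz_split[OF that, of K] E_def)
      qed
      have E: "(\<Sum>k<n. (\<Sum>l<n. E k l * y l)\<^sup>2) \<le> (4 * \<delta>)\<^sup>2 * (\<Sum>l<n. (y l)\<^sup>2)" for y
      proof -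
        let ?a = "\<lambda>k. \<Sum>l<n. off_band K k l * y l" and ?b = "\<lambda>k. \<Sum>l<n. gamma_mat n d $$ (k, l) * y l"
        have "(\<Sum>k<n. (\<Sum>l<n. E k l * y l)\<^sup>2) = (\<Sum>k<n. (?a k - ?b k)\<^sup>2)"
          by (simp add: E_def left_diff_distrib sum_subtractf)
        also have "\<dots> \<le> (\<Sum>k<n. 2 * (?a k)\<^sup>2 + 2 * (?b k)\<^sup>2)"
        proof (intro sum_mono)
          fix k
          have "0 \<le> (?a k + ?b k)\<^sup>2" by simp
          then show "(?a k - ?b k)\<^sup>2 \<le> 2 * (?a k)\<^sup>2 + 2 * (?b k)\<^sup>2"
            by (simp add: power2_sum power2_diff)
        qed
        also have "\<dots> = 2 * (\<Sum>k<n. (?a k)\<^sup>2) + 2 * (\<Sum>k<n. (?b k)\<^sup>2)"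
          by (simp only: sum.distrib sum_distrib_left)
        also have "\<dots> \<le> 2 * (\<delta>\<^sup>2 * (\<Sum>l<n. (y l)\<^sup>2)) + 2 * ((2 * \<delta>)\<^sup>2 * (\<Sum>l<n. (y l)\<^sup>2))"
          using n0(2)[OF n]
          by (intro add_mono mult_left_mono off_band_norm_le[OF K] gamma_mat_norm_le) (auto simp: d_def)
        also have "\<dots> = 10 * (\<delta>\<^sup>2 * (\<Sum>l<n. (y l)\<^sup>2))" by (simp add: power2_eq_square)
        \<comment> \<open>Rounding 10 up to 16 yields a perfect square.\<close>
        also have "\<dots> \<le> 16 * (\<delta>\<^sup>2 * (\<Sum>l<n. (y l)\<^sup>2))"
          by (intro mult_right_mono mult_nonneg_nonneg sum_nonneg) auto
        also have "\<dots> = (4 * \<delta>)\<^sup>2 * (\<Sum>l<n. (y l)\<^sup>2)" by (simp add: power2_eq_square)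
        finally show ?thesis .
      qed
      let ?M = "eigenvalue_mset (inv_mat (G n) * toeplitz t n)"
      \<comment> \<open>\<open>corner_eq_0\<close> needs both indices below \<open>n\<close>,
        whereas the row condition on the low-rank part ranges over all \<open>l\<close>; hence the
        cut-off.\<close>
      define R where "R k l = (if k < n \<and> l < n then corner K n k l else 0)" for k l
      have a2: "a / 2 > 0" and \<eta>: "4 * \<delta> \<ge> 0" using a \<delta>(1) by simp_all
      have split': "\<And>k l. k < n \<Longrightarrow> l < n \<Longrightarrow> toeplitz t n $$ (k, l) = G n $$ (k, l) + R k l + E k l"
        using split by (simp add: R_def)
      have R0: "\<And>k l. k < n \<Longrightarrow> k \<notin> border K n \<Longrightarrow> R k l = 0"
        by (simp add: R_def corner_eq_0)
      note pc = preconditioned_eigenvalue_count[OF Gn gamma_Q_carrier gamma_Q_orthogonal(2) T symT s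
          a2 pos card_border(1)[of K n] split' R0 E \<eta>]
      have count: "invertible_mat (G n)"
        "size {#\<mu> \<in># ?M. cmod (\<mu> - 1) > 4 * \<delta> / (a / 2)#} \<le> card (border K n)"
        by (rule pc; assumption)+
      have "size {#\<mu> \<in># ?M. cmod (\<mu> - 1) > \<epsilon>#} \<le> size {#\<mu> \<in># ?M. cmod (\<mu> - 1) > 4 * \<delta> / (a / 2)#}"
        using \<delta>(3) by (intro size_mset_mono filter_mset_mono_strong) auto
      then show ?thesis using count card_border(2)[of K n] by linarith
    qed
    then show "\<exists>k n1. n1 > 0 \<and> (\<forall>n\<ge>n1. invertible_mat (G n) \<and>
          size {#\<mu> \<in># eigenvalue_mset (inv_mat (G n) * toeplitz t n). cmod (\<mu> - 1) > \<epsilon>#} < k)"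
      using n0(1) by blast
  qed
qed

end
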